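(* Fix $n,k$, let $X=X_{n,k}$ be the moduli space of rank $n$ metric holocoloured graphs with $k$ external edges, let $m_c\ge 0$, $c\in C=\{1,\dots,3(n-1)+k\}$, be a set of masses, one for each colour, and let $p=(p_1,\dots,p_k)\in(\mathbb R^d)^k$ be a generic external momentum configuration. Let $t=t(p)=\{t_G\}_G$ be the Feynman piecewise distribution on $X$, where for every coloured graph $G$ indexing a cell of $X$, $$t_G: C_c^\infty(\sigma_G)\to\mathbb C,\qquad \varphi\mapsto\langle t_G\mid\varphi\rangle=\int_{\sigma_G}\varphi\,\omega_G .$$ Then $t$ is a piecewise distribution on $C_c^\infty(X)$ that respects face relations.
   Context: Graphs. A graph $G$ has vertices, internal edges $E(G)$ (multi-edges and self-loops allowed) and $k$ legs attached to vertices. Rank $|G|$ = first Betti number; $N=|E(G)|$. $G$ is admissible of rank $n$ if it is connected, $|G|=n$, deleting any internal edge lowers the rank, and all vertices have valence at least $3$ (legs are counted). A forest is a subgraph (subset of edges) of rank $0$; $G/F$ is obtained by contracting each component of $F$ to a vertex. A holocoloured graph is an admissible $G$ with an injective colouring $c:E(G)\to C=\{1,\dots,3(n-1)+k\}$; $G/F$ carries the restricted colouring. The space $X=X_{n,k}$: equivalence classes of triples $(G,\lambda,c)$, $(G,c)$ holocoloured of rank $n$ with $k$ legs, $\lambda:E(G)\to\mathbb R_{>0}$, up to colour-respecting homotheties. $X$ is a disjoint union of open simplices $\{(x_e): x_e>0,\ \sum x_e=1\}$, one for each holocoloured $G$. $\sigma_G$ denotes the open simplex of $G$ together with its faces $\{x_e=0,\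 e\in E(F)\}$, $F$ a forest in $G$; this face is $\sigma_{G/F}$. The other faces of the closed simplex are missing from $X$. Projectively, $\sigma_G\subset\{[x_1:\dots:x_N]:x_i\ge0\}\subset\mathbb P(\mathbb R^N)$. External data. $d$ is a positive even integer; $p_i\in\mathbb R^d$ (Euclidean or Minkowski) are attached to the legs, with $\sum_i p_i=0$; $(\cdot)^2$ is the corresponding quadratic form. Generic means $(\sum_{i\in I}p_i)^2>0$ for all $\emptyset\ne I\subsetneq\{1,\dots,k\}$. The edge $e$ has mass $m_{c(e)}$. Integrand. For connected $G$: $\psi_G=\sum_{T}\prod_{e\notin T}x_e$ over spanning trees $T$; $\phi_G=\sum_{T_1\cup T_2}(p^{T_1})^2\prod_{e\notin T_1\cup T_2}x_e$ over spanning 2-forests (disjoint unions of two trees covering all vertices), $p^{T_1}$ being the sum of momenta of legs attached to vertices of $T_1$; $\Xi_G=\phi_G+\psi_G\sum_e m_{c(e)}^2x_e$. Define $$f_G=\psi_G^{-d/2}\Big(\frac{\psi_G}{\Xi_G}\Big)^{N-|G|d/2}=\psi_G^{-d/2}\Big(\frac{\psi_G}{\Xi_G}\Big)^{-s_G/2},\qquad \omega_G=f_G\,\nu_G,\qquad \nu_G=\sum_{i=1}^N(-1)^ix_i\,dx_1\wedge\dots\wedge\widehat{dx_i}\wedge\dots\wedge dx_N.$$ Here $s_G=d|G|-2N$ is the superficial degree of divergence, regarded as the (discontinuous) function on $\sigma_G$ given by $s_G=dn-2\sum_{e\in E(G)}(2\theta(x_e)-1)$ with $\theta(x)=0,\tfrac12,1$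 for $x<0$, $x=0$, $x>0$; so on the face $\sigma_{G/F}$ where exactly the edges of $F$ have length $0$ it takes the value $d|G/F|-2|E(G/F)|$. Piecewise distributions. A piecewise distribution on $X$ is a collection $u=\{u_\sigma\}$ with $u_\sigma$ a distribution on each cell $\sigma=\sigma_G$ (a manifold with corners; test functions are smooth functions compactly supported in $\sigma_G$, i.e. supports stay away from the missing faces), with value $\langle u\mid\varphi\rangle=\sum_\sigma\langle u_\sigma\mid\varphi|_\sigma\rangle$ on $\varphi\in C_c^\infty(X)$. It respects face relations if $u_\tau=u_\sigma|_\tau$ whenever $\tau$ is a face of $\sigma$, where the restriction of a regular distribution $u$ (given by a function) to a submanifold $S$, locally $S=\{x_1=\dots=x_j=0\}$, is defined by $\langle u|_S\mid\varphi\rangle=\int\varphi(x)u(x)\prod_{i=1}^j\delta(x_i)\,dx$, i.e. by evaluating the integrand (including the discontinuous exponent $s_G$) on $S$ and integrating over $S$.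
   Formalization: Added hypothesis: wherever Ξ_G vanishes on σ_G, the superficial degree s_G is positive there. Without it the integrals can diverge (e.g. the massless bubble with d=2, n=1, k=2, where f_G=1/(p²x₁x₂)). *)

theory Defs
  imports "HOL-Analysis.Analysis" "HOL-Probability.Giry_Monad"
begin

section \<open>Holocoloured graphs\<close>

text \<open>
  The finite type \<^typ>\<open>'c\<close> is the set of colours. As the colouring of a holocoloured graph is
  injective, an edge is identified with its colour: the internal edges form a subset of
  \<^typ>\<open>'c\<close>, the colouring is the inclusion, and every restriction of it is again the inclusion.
  \<open>ends G e\<close> is the set of end points of \<open>e\<close> (a singleton for a self-loop), and leg \<open>i\<close>,
  for \<open>1 \<le> i \<le> k\<close>, is attached to the vertex \<open>leg G i\<close>. Values of \<open>ends\<close> and \<open>leg\<close>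
  at other arguments are irrelevant. Vertices are natural numbers, so graphs only matter up to
  the isomorphisms defined below.
\<close>

record 'c cgraph =
  verts :: "nat set"
  edges :: "'c set"
  ends :: "'c \<Rightarrow> nat set"
  leg :: "nat \<Rightarrow> nat"

definition wf_cgraph :: "nat \<Rightarrow> 'c::finite cgraph \<Rightarrow> bool" where
  "wf_cgraph k G \<longleftrightarrow> finite (verts G) \<and> verts G \<noteq> {} \<and>
     (\<forall>e\<in>edges G. ends G e \<subseteq> verts G \<and> card (ends G e) \<in> {1, 2}) \<and>
     (\<forall>i\<in>{1..k}. leg G i \<in> verts G)"

definition adjacent :: "'c cgraph \<Rightarrow> 'c set \<Rightarrow> (nat \<times> nat) set" where
  "adjacent G F = {(u, v). \<exists>e\<in>F. ends G e = {u, v}}"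

text \<open>A subset \<open>F\<close> of the edges stands for the subgraph with edge set \<open>F\<close> and all vertices.\<close>

definition components :: "'c cgraph \<Rightarrow> 'c set \<Rightarrow> nat set set" where
  "components G F = verts G // (adjacent G F)\<^sup>*"

definition betti :: "'c cgraph \<Rightarrow> 'c set \<Rightarrow> int" where
  "betti G F = int (card F) - int (card (verts G)) + int (card (components G F))"

definition graph_connected :: "'c cgraph \<Rightarrow> 'c set \<Rightarrow> bool" where
  "graph_connected G F \<longleftrightarrow> (\<forall>u\<in>verts G. \<forall>v\<in>verts G. (u, v) \<in> (adjacent G F)\<^sup>*)"

definition valence :: "nat \<Rightarrow> 'c cgraph \<Rightarrow> nat \<Rightarrow> nat" where
  "valence k G v = card {e \<in> edges G. v \<in> ends G e} + card {e \<in> edges G. ends G e = {v}}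
     + card {i \<in> {1..k}. leg G i = v}"

definition admissible :: "nat \<Rightarrow> nat \<Rightarrow> 'c::finite cgraph \<Rightarrow> bool" where
  "admissible n k G \<longleftrightarrow> wf_cgraph k G \<and> graph_connected G (edges G) \<and>
     betti G (edges G) = int n \<and>
     (\<forall>e\<in>edges G. betti G (edges G - {e}) < betti G (edges G)) \<and>
     (\<forall>v\<in>verts G. valence k G v \<ge> 3)"

definition holocoloured :: "nat \<Rightarrow> nat \<Rightarrow> 'c::finite cgraph set" where
  "holocoloured n k = {G. admissible n k G}"

definition forest :: "'c cgraph \<Rightarrow> 'c set \<Rightarrow> bool" where
  "forest G F \<longleftrightarrow> F \<subseteq> edges G \<and> betti G F = 0"

text \<open>In \<open>G/F\<close> each component of \<open>F\<close> is represented by its least vertex.\<close>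

definition component_rep :: "'c cgraph \<Rightarrow> 'c set \<Rightarrow> nat \<Rightarrow> nat" where
  "component_rep G F v = (LEAST w. (v, w) \<in> (adjacent G F)\<^sup>*)"

definition contract :: "'c cgraph \<Rightarrow> 'c set \<Rightarrow> 'c cgraph" where
  "contract G F =
     \<lparr> verts = component_rep G F ` verts G,
       edges = edges G - F,
       ends = (\<lambda>e. component_rep G F ` ends G e),
       leg = (\<lambda>i. component_rep G F (leg G i)) \<rparr>"

text \<open>Isomorphisms respect colours, hence are the identity on edges, and fix the legs.\<close>

definition isomorphic :: "nat \<Rightarrow> 'c cgraph \<Rightarrow> 'c cgraph \<Rightarrow> bool" where
  "isomorphic k G H \<longleftrightarrow> edges G = edges H \<and>
     (\<exists>g. bij_betw g (verts G) (verts H) \<and>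
          (\<forall>e\<in>edges G. ends H e = g ` ends G e) \<and>
          (\<forall>i\<in>{1..k}. leg H i = g (leg G i)))"

definition iso_class :: "nat \<Rightarrow> nat \<Rightarrow> 'c::finite cgraph \<Rightarrow> 'c cgraph set" where
  "iso_class n k G = {H \<in> holocoloured n k. isomorphic k G H}"


section \<open>Cells and the moduli space\<close>

text \<open>
  A metric graph is represented, up to homothety, by the vector \<open>x\<close> of its edge lengths, extended
  by \<open>0\<close> to all colours and normalised to total length \<open>1\<close>. With this convention the face of
  \<open>cell G\<close> on which the edges of a forest \<open>F\<close> have length \<open>0\<close> is literally
  \<open>cell (contract G F)\<close>.
\<close>

definition open_simplex :: "'c::finite set \<Rightarrow> (real ^ 'c) set" where
  "open_simplex E = {x. (\<forall>e\<in>E. 0 < x $ e) \<and> (\<forall>e. e \<notin> E \<longrightarrow> x $ e = 0) \<and> (\<Sum>e\<in>E. x $ e) = 1}"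

definition zero_edges :: "'c::finite cgraph \<Rightarrow> (real ^ 'c) \<Rightarrow> 'c set" where
  "zero_edges G x = {e \<in> edges G. x $ e = 0}"

definition cell :: "'c::finite cgraph \<Rightarrow> (real ^ 'c) set" where
  "cell G = {x. (\<forall>e\<in>edges G. 0 \<le> x $ e) \<and> (\<forall>e. e \<notin> edges G \<longrightarrow> x $ e = 0) \<and>
     (\<Sum>e\<in>edges G. x $ e) = 1 \<and> forest G (zero_edges G x)}"

definition moduli_space :: "nat \<Rightarrow> nat \<Rightarrow> ('c::finite cgraph set \<times> (real ^ 'c)) set" where
  "moduli_space n k = {(iso_class n k G, x) | G x. G \<in> holocoloured n k \<and> x \<in> open_simplex (edges G)}"

definition cell_map :: "nat \<Rightarrow> nat \<Rightarrow> 'c::finite cgraph \<Rightarrow> (real ^ 'c) \<Rightarrow> 'c cgraph set \<times> (real ^ 'c)" where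
  "cell_map n k G x = (iso_class n k (contract G (zero_edges G x)), x)"


section \<open>Test functions and distributions\<close>

primrec Ck_on :: "nat \<Rightarrow> 'a::euclidean_space set \<Rightarrow> ('a \<Rightarrow> complex) \<Rightarrow> bool" where
  "Ck_on 0 U f \<longleftrightarrow> continuous_on U f"
| "Ck_on (Suc r) U f \<longleftrightarrow> (\<forall>x\<in>U. f differentiable (at x)) \<and>
     (\<forall>v. Ck_on r U (\<lambda>x. frechet_derivative f (at x) v))"

definition smooth_on :: "'a::euclidean_space set \<Rightarrow> ('a \<Rightarrow> complex) \<Rightarrow> bool" where
  "smooth_on U f \<longleftrightarrow> (\<forall>r. Ck_on r U f)"

text \<open>
  Smoothness on a manifold with corners: local existence of smooth extensions to the ambient space.
  Functions on \<open>cell G\<close> are represented by their extensions by \<open>0\<close>. The support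
  has to be compact inside \<open>cell G\<close>, so it avoids the missing faces but may meet the others.
\<close>

definition test_functions :: "'c::finite cgraph \<Rightarrow> ((real ^ 'c) \<Rightarrow> complex) set" where
  "test_functions G = {\<phi>.
     (\<forall>x\<in>cell G. \<exists>U g. open U \<and> x \<in> U \<and> smooth_on U g \<and> (\<forall>y\<in>U \<inter> cell G. \<phi> y = g y)) \<and>
     (\<exists>K. compact K \<and> K \<subseteq> cell G \<and> (\<forall>x. x \<notin> K \<longrightarrow> \<phi> x = 0))}"

primrec iterated_deriv :: "(real ^ 'c::finite) list \<Rightarrow> ((real ^ 'c) \<Rightarrow> complex) \<Rightarrow> (real ^ 'c) \<Rightarrow> complex" where
  "iterated_deriv [] \<phi> = \<phi>"
| "iterated_deriv (v # vs) \<phi> =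
     (\<lambda>x. vector_derivative (\<lambda>h. iterated_deriv vs \<phi> (x + h *\<^sub>R v)) (at 0))"

definition tangent_directions :: "'c::finite set \<Rightarrow> (real ^ 'c) set" where
  "tangent_directions E = {axis i 1 - axis j 1 | i j. i \<in> E \<and> j \<in> E}"

text \<open>
  Convergence to \<open>0\<close> in the space of test functions. Derivatives are taken along the simplex and
  in its interior; the latter is dense in the cell, so this controls all derivatives up to the faces.
\<close>

definition tends_to_zero :: "'c::finite cgraph \<Rightarrow> (nat \<Rightarrow> (real ^ 'c) \<Rightarrow> complex) \<Rightarrow> bool" where
  "tends_to_zero G \<phi> \<longleftrightarrow>
     (\<exists>K. compact K \<and> K \<subseteq> cell G \<and> (\<forall>j x. x \<notin> K \<longrightarrow> \<phi> j x = 0)) \<and>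
     (\<forall>vs. set vs \<subseteq> tangent_directions (edges G) \<longrightarrow>
        uniform_limit (open_simplex (edges G)) (\<lambda>j. iterated_deriv vs (\<phi> j)) (\<lambda>_. 0) sequentially)"

definition distribution :: "'c::finite cgraph \<Rightarrow> (((real ^ 'c) \<Rightarrow> complex) \<Rightarrow> complex) \<Rightarrow> bool" where
  "distribution G u \<longleftrightarrow>
     (\<forall>\<phi>\<in>test_functions G. \<forall>\<psi>\<in>test_functions G. \<forall>a b.
        u (\<lambda>x. a * \<phi> x + b * \<psi> x) = a * u \<phi> + b * u \<psi>) \<and>
     (\<forall>\<phi>. (\<forall>j. \<phi> j \<in> test_functions G) \<and> tends_to_zero G \<phi> \<longrightarrow> (\<lambda>j. u (\<phi> j)) \<longlonglongrightarrow> 0)"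

definition restrict_to_cell ::
  "nat \<Rightarrow> nat \<Rightarrow> ('c::finite cgraph set \<times> (real ^ 'c) \<Rightarrow> complex) \<Rightarrow> 'c cgraph \<Rightarrow> (real ^ 'c) \<Rightarrow> complex" where
  "restrict_to_cell n k \<Phi> G = (\<lambda>x. if x \<in> cell G then \<Phi> (cell_map n k G x) else 0)"

text \<open>
  The space \<open>moduli_space n k\<close> is a finite union of images of cells, so a function on it has compact
  support iff all of its restrictions to cells have.
\<close>

definition moduli_test_functions ::
  "nat \<Rightarrow> nat \<Rightarrow> ('c::finite cgraph set \<times> (real ^ 'c) \<Rightarrow> complex) set" where
  "moduli_test_functions n k = {\<Phi>. (\<forall>z. z \<notin> moduli_space n k \<longrightarrow> \<Phi> z = 0) \<and>
     (\<forall>G\<in>holocoloured n k. restrict_to_cell n k \<Phi> G \<in> test_functions G)}"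

definition evaluate ::
  "nat \<Rightarrow> nat \<Rightarrow> ('c::finite cgraph \<Rightarrow> ((real ^ 'c) \<Rightarrow> complex) \<Rightarrow> complex) \<Rightarrow>
     ('c cgraph set \<times> (real ^ 'c) \<Rightarrow> complex) \<Rightarrow> complex" where
  "evaluate n k u \<Phi> = (\<Sum>\<G>\<in>iso_class n k ` holocoloured n k.
     let G = (SOME G. G \<in> \<G>) in u G (restrict_to_cell n k \<Phi> G))"

text \<open>
  The cells are indexed by isomorphism classes of graphs. The second condition says that the family
  \<open>u\<close>, which is indexed by graphs, is a family indexed by cells.
\<close>

definition piecewise_distribution ::
  "nat \<Rightarrow> nat \<Rightarrow> ('c::finite cgraph \<Rightarrow> ((real ^ 'c) \<Rightarrow> complex) \<Rightarrow> complex) \<Rightarrow> bool" where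
  "piecewise_distribution n k u \<longleftrightarrow>
     (\<forall>G\<in>holocoloured n k. distribution G (u G)) \<and>
     (\<forall>G\<in>holocoloured n k. \<forall>H\<in>holocoloured n k. isomorphic k G H \<longrightarrow>
        (\<forall>\<phi>\<in>test_functions G. u G \<phi> = u H \<phi>)) \<and>
     (\<forall>\<Phi>\<in>moduli_test_functions n k. \<forall>\<Psi>\<in>moduli_test_functions n k. \<forall>a b.
        evaluate n k u (\<lambda>z. a * \<Phi> z + b * \<Psi> z) = a * evaluate n k u \<Phi> + b * evaluate n k u \<Psi>)"


section \<open>Regular distributions and their restrictions to faces\<close>

text \<open>
  On the hyperplane of total length \<open>1\<close>, the coordinates \<open>x\<^sub>e\<close> with \<open>e \<noteq> e\<^sub>0\<close> are affine
  coordinates, in which the form \<open>\<nu>\<^sub>G\<close> becomes plus or minus \<open>\<Prod>\<^bsub>e\<noteq>e\<^sub>0\<^esub> dx\<^sub>e\<close>. Cells are oriented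
  such that \<open>\<nu>\<^sub>G\<close> is positive, so integration against \<open>\<nu>\<^sub>G\<close> is integration against
  \<open>hyperplane_measure (edges G) {}\<close>, Lebesgue measure in these coordinates. It does not depend on
  \<open>e\<^sub>0\<close>, as different choices are related by affine maps of determinant plus or minus \<open>1\<close>.
  \<open>hyperplane_measure E F\<close> is the measure \<open>(\<Prod>\<^bsub>e\<in>F\<^esub> \<delta>(x\<^sub>e)) dx\<close>; here \<open>e\<^sub>0\<close> must not be in \<open>F\<close>.
\<close>

definition hyperplane_point :: "'c::finite set \<Rightarrow> 'c \<Rightarrow> ('c \<Rightarrow> real) \<Rightarrow> (real ^ 'c)" where
  "hyperplane_point E e\<^sub>0 y =
     (\<chi> e. if e = e\<^sub>0 then 1 - (\<Sum>e'\<in>E - {e\<^sub>0}. y e') else if e \<in> E then y e else 0)"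

definition hyperplane_measure :: "'c::finite set \<Rightarrow> 'c set \<Rightarrow> (real ^ 'c) measure" where
  "hyperplane_measure E F = (let e\<^sub>0 = (SOME e. e \<in> E - F) in
     distr (PiM (E - {e\<^sub>0}) (\<lambda>e. if e \<in> F then return lborel 0 else lborel)) borel
       (hyperplane_point E e\<^sub>0))"

definition regular_distribution ::
  "'c::finite cgraph \<Rightarrow> ((real ^ 'c) \<Rightarrow> real) \<Rightarrow> ((real ^ 'c) \<Rightarrow> complex) \<Rightarrow> complex" where
  "regular_distribution G h \<phi> =
     (LINT x:cell G|hyperplane_measure (edges G) {}. \<phi> x * complex_of_real (h x))"

definition face_restriction ::
  "'c::finite cgraph \<Rightarrow> 'c set \<Rightarrow> ((real ^ 'c) \<Rightarrow> real) \<Rightarrow> ((real ^ 'c) \<Rightarrow> complex) \<Rightarrow> complex" where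
  "face_restriction G F h \<phi> =
     (LINT x:cell G|hyperplane_measure (edges G) F. \<phi> x * complex_of_real (h x))"

text \<open>
  The family \<open>h\<close> consists of the densities of a regular piecewise distribution. Restriction
  to a face depends on the values of a density on this face, not only on its almost everywhere class.
\<close>

definition respects_face_relations ::
  "nat \<Rightarrow> nat \<Rightarrow> ('c::finite cgraph \<Rightarrow> (real ^ 'c) \<Rightarrow> real) \<Rightarrow> bool" where
  "respects_face_relations n k h \<longleftrightarrow>
     (\<forall>G\<in>holocoloured n k. \<forall>F. forest G F \<longrightarrow>
        (\<forall>\<phi>\<in>test_functions (contract G F).
           regular_distribution (contract G F) (h (contract G F)) \<phi> = face_restriction G F (h G) \<phi>))"


section \<open>External momenta\<close>

definition minkowski_form :: "'d::finite \<Rightarrow> (real ^ 'd) \<Rightarrow> real" where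
  "minkowski_form \<tau> v = (v $ \<tau>)\<^sup>2 - (\<Sum>\<mu>\<in>UNIV - {\<tau>}. (v $ \<mu>)\<^sup>2)"

text \<open>Both sign conventions for the Minkowski form are admitted.\<close>

definition spacetime_form :: "((real ^ 'd::finite) \<Rightarrow> real) \<Rightarrow> bool" where
  "spacetime_form q \<longleftrightarrow> q = (\<lambda>v. v \<bullet> v) \<or>
     (\<exists>\<tau>. q = minkowski_form \<tau>) \<or> (\<exists>\<tau>. q = (\<lambda>v. - minkowski_form \<tau> v))"

definition generic_momenta :: "((real ^ 'd::finite) \<Rightarrow> real) \<Rightarrow> nat \<Rightarrow> (nat \<Rightarrow> (real ^ 'd)) \<Rightarrow> bool" where
  "generic_momenta q k p \<longleftrightarrow> (\<Sum>i\<in>{1..k}. p i) = 0 \<and>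
     (\<forall>I. I \<noteq> {} \<and> I \<subset> {1..k} \<longrightarrow> q (\<Sum>i\<in>I. p i) > 0)"


section \<open>The Feynman integrand\<close>

definition spanning_trees :: "'c cgraph \<Rightarrow> 'c set set" where
  "spanning_trees G = {T. forest G T \<and> graph_connected G T}"

definition spanning_2_forests :: "'c cgraph \<Rightarrow> 'c set set" where
  "spanning_2_forests G = {T. forest G T \<and> card (components G T) = 2}"

definition psi :: "'c::finite cgraph \<Rightarrow> (real ^ 'c) \<Rightarrow> real" where
  "psi G x = (\<Sum>T\<in>spanning_trees G. \<Prod>e\<in>edges G - T. x $ e)"

text \<open>
  \<open>T\<^sub>1\<close> is one of the two components of the 2-forest; by momentum conservation the choice does
  not affect the square of the momentum.
\<close>

definition phi ::
  "((real ^ 'd::finite) \<Rightarrow> real) \<Rightarrow> nat \<Rightarrow> (nat \<Rightarrow> (real ^ 'd)) \<Rightarrow> 'c::finite cgraph \<Rightarrow> (real ^ 'c) \<Rightarrow> real" where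
  "phi q k p G x = (\<Sum>T\<in>spanning_2_forests G.
     let T\<^sub>1 = (SOME A. A \<in> components G T)
     in q (\<Sum>i\<in>{i\<in>{1..k}. leg G i \<in> T\<^sub>1}. p i) * (\<Prod>e\<in>edges G - T. x $ e))"

definition Xi ::
  "((real ^ 'd::finite) \<Rightarrow> real) \<Rightarrow> nat \<Rightarrow> (nat \<Rightarrow> (real ^ 'd)) \<Rightarrow> ('c \<Rightarrow> real) \<Rightarrow>
     'c::finite cgraph \<Rightarrow> (real ^ 'c) \<Rightarrow> real" where
  "Xi q k p m G x = phi q k p G x + psi G x * (\<Sum>e\<in>edges G. (m e)\<^sup>2 * x $ e)"

definition heaviside :: "real \<Rightarrow> real" where
  "heaviside x = (if x < 0 then 0 else if x = 0 then 1 / 2 else 1)"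

definition superficial_degree :: "nat \<Rightarrow> 'c::finite cgraph \<Rightarrow> (real ^ 'c) \<Rightarrow> real" where
  "superficial_degree d G x =
     real d * real_of_int (betti G (edges G)) - 2 * (\<Sum>e\<in>edges G. 2 * heaviside (x $ e) - 1)"

definition feynman_density ::
  "((real ^ 'd::finite) \<Rightarrow> real) \<Rightarrow> nat \<Rightarrow> (nat \<Rightarrow> (real ^ 'd)) \<Rightarrow> ('c \<Rightarrow> real) \<Rightarrow>
     'c::finite cgraph \<Rightarrow> (real ^ 'c) \<Rightarrow> real" where
  "feynman_density q k p m G x =
     psi G x powr (- (real CARD('d) / 2)) *
     (psi G x / Xi q k p m G x) powr (- (superficial_degree CARD('d) G x / 2))"

text \<open>
  On \<open>cell G\<close>, \<open>psi\<close> is positive but \<open>Xi\<close> may vanish if some masses do. Where this happens, the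
  density makes sense only if the exponent of \<open>psi / Xi\<close> is negative; it is then \<open>0\<close>,
  in accordance with the conventions \<open>a / 0 = 0\<close> and \<open>0 powr b = 0\<close>. This holds for
  all graphs if all masses are positive.
\<close>

definition feynman_density_defined ::
  "((real ^ 'd::finite) \<Rightarrow> real) \<Rightarrow> nat \<Rightarrow> (nat \<Rightarrow> (real ^ 'd)) \<Rightarrow> ('c \<Rightarrow> real) \<Rightarrow>
     'c::finite cgraph \<Rightarrow> bool" where
  "feynman_density_defined q k p m G \<longleftrightarrow>
     (\<forall>x\<in>cell G. Xi q k p m G x = 0 \<longrightarrow> superficial_degree CARD('d) G x > 0)"

definition feynman_distribution ::
  "((real ^ 'd::finite) \<Rightarrow> real) \<Rightarrow> nat \<Rightarrow> (nat \<Rightarrow> (real ^ 'd)) \<Rightarrow> ('c \<Rightarrow> real) \<Rightarrow>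
     'c::finite cgraph \<Rightarrow> ((real ^ 'c) \<Rightarrow> complex) \<Rightarrow> complex" where
  "feynman_distribution q k p m G = regular_distribution G (feynman_density q k p m G)"

end

theory Submission
  imports Defs "HOL-Probability.Infinite_Product_Measure"
begin

text \<open>
  Compatibility with faces and isomorphisms is combinatorial: the spanning trees and 2-forests of
  \<open>G/F\<close> correspond to those of \<open>G\<close> containing \<open>F\<close>, and the monomials of all others vanish where
  the edges of \<open>F\<close> have length \<open>0\<close>; the factors \<open>\<delta>(x\<^sub>e)\<close> are integrated out by Fubini.

  The analytic point is local integrability of the density, which is unbounded near the faces
  where \<open>Xi\<close> vanishes. For a spanning tree \<open>T\<close>, put \<open>w x = (\<Prod>e\<in>edges G - T. x $ e)\<close> and
  \<open>c e = (m e)\<^sup>2\<close>, increased by the squared momentum of the 2-forest \<open>T - {e}\<close> if \<open>e \<in> T\<close>. Then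
  \<open>Xi \<ge> w x * (\<Sum>e\<in>edges G. c e * x $ e)\<close>, and on a compact subset of the cell some \<open>w\<close> is bounded
  below, since \<open>psi\<close> is the sum of the \<open>w\<close>. Let \<open>S\<close> be the set of all \<open>e\<close> with \<open>c e > 0\<close>. If
  \<open>S\<close> is not contained in \<open>T\<close>, this bounds \<open>Xi\<close> away from \<open>0\<close>. Otherwise \<open>Xi\<close> vanishes on the
  face where exactly the edges of \<open>S\<close> have length \<open>0\<close>: no edge of \<open>T - S\<close> separates legs, so \<open>S\<close>
  connects all of them. Positivity of the superficial degree there says that the singular
  exponent \<open>a\<close> is less than \<open>card S\<close>, hence \<open>(\<Sum>e\<in>S. x $ e) powr - a\<close>, which is at most the
  product of the \<open>(x $ e) powr - (a / card S)\<close>, is integrable.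
\<close>

section \<open>Connectivity and Betti numbers\<close>

abbreviation conn :: "'c cgraph \<Rightarrow> 'c set \<Rightarrow> (nat \<times> nat) set" where
  "conn G F \<equiv> (adjacent G F)\<^sup>*"

lemma conn_sym: "(u, v) \<in> conn G F \<Longrightarrow> (v, u) \<in> conn G F"
proof -
  have "sym (adjacent G F)"
    by (auto simp: sym_def adjacent_def insert_commute)
  then show "(u, v) \<in> conn G F \<Longrightarrow> (v, u) \<in> conn G F"
    by (meson sym_rtrancl symD)
qed

lemma equiv_conn: "equiv UNIV (conn G F)"
  by (intro equivI refl_rtrancl sym_rtrancl trans_rtrancl) (auto simp: sym_def adjacent_def insert_commute)

lemma conn_class_eq: "conn G F `` {u} = conn G F `` {v} \<longleftrightarrow> (u, v) \<in> conn G F"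
  using eq_equiv_class_iff[OF equiv_conn, of u v] by simp

lemma conn_mono: "A \<subseteq> B \<Longrightarrow> conn G A \<subseteq> conn G B"
  by (intro rtrancl_mono) (auto simp: adjacent_def)

lemma conn_edge: "e \<in> F \<Longrightarrow> ends G e = {a, b} \<Longrightarrow> (a, b) \<in> conn G F"
  by (intro r_into_rtrancl) (auto simp: adjacent_def)

text \<open>A walk that uses \<open>e\<close> twice can be shortened: the second use either repeats
  the first or undoes it. Writing the ends as \<open>{a, b}\<close> covers both orientations and
  self-loops.\<close>

lemma conn_insert:
  "(u, v) \<in> conn G (insert e F) \<longleftrightarrow>
     (u, v) \<in> conn G F \<or> (\<exists>a b. ends G e = {a, b} \<and> (u, a) \<in> conn G F \<and> (b, v) \<in> conn G F)"
    (is "_ \<longleftrightarrow> ?R v")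
proof
  assume "(u, v) \<in> conn G (insert e F)"
  then show "?R v"
  proof (induction rule: rtrancl_induct)
    case (step y z)
    from step.hyps(2) consider "(y, z) \<in> adjacent G F" | "ends G e = {y, z}"
      by (auto simp: adjacent_def)
    then show ?case
    proof cases
      case 1
      with step.IH show ?thesis
        by (meson rtrancl.rtrancl_into_rtrancl)
    next
      case 2
      from step.IH show ?thesis
      proof
        assume "\<exists>a b. ends G e = {a, b} \<and> (u, a) \<in> conn G F \<and> (b, y) \<in> conn G F"
        then obtain a b where "ends G e = {a, b}" "(u, a) \<in> conn G F" by blast
        with 2 have "a = y \<and> b = z \<or> a = z \<and> b = y"
          by (metis doubleton_eq_iff)
        with \<open>(u, a) \<in> conn G F\<close> 2 show ?thesis
          by blast
      qed (use 2 in blast)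
    qed
  qed auto
next
  have sub: "conn G F \<subseteq> conn G (insert e F)"
    by (rule conn_mono) auto
  assume "?R v"
  then show "(u, v) \<in> conn G (insert e F)"
  proof
    assume "\<exists>a b. ends G e = {a, b} \<and> (u, a) \<in> conn G F \<and> (b, v) \<in> conn G F"
    then obtain a b where "ends G e = {a, b}" "(u, a) \<in> conn G F" "(b, v) \<in> conn G F"
      by blast
    moreover from this have "(a, b) \<in> conn G (insert e F)"
      by (intro conn_edge[of e]) auto
    ultimately show ?thesis
      using sub by (meson rtrancl_trans subsetD)
  qed (use sub in blast)
qed

lemma conn_insert_redundant:
  assumes "ends G e = {a, b}" "(a, b) \<in> conn G F"
  shows "conn G (insert e F) = conn G F"
proof -
  have "(u, v) \<in> conn G F" if uv: "(u, v) \<in> conn G (insert e F)" for u v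
  proof (rule ccontr)
    assume n: "(u, v) \<notin> conn G F"
    with uv obtain a' b' where ab': "ends G e = {a', b'}" "(u, a') \<in> conn G F" "(b', v) \<in> conn G F"
      using conn_insert by metis
    with assms have "(a', b') \<in> conn G F"
      by (metis conn_sym doubleton_eq_iff)
    with ab' n show False
      by (meson rtrancl_trans)
  qed
  with conn_mono[of F "insert e F" G] show ?thesis
    by auto
qed

text \<open>Replaces explicit bijections between quotients: to compare two counts of components it
  suffices to compare when two vertices have the same class.\<close>

lemma card_image_kernel:
  assumes "\<And>u v. u \<in> V \<Longrightarrow> v \<in> V \<Longrightarrow> g u = g v \<longleftrightarrow> h u = h v"
  shows "card (g ` V) = card (h ` V)"
proof (rule bij_betw_same_card)
  show "bij_betw (\<lambda>y. h (inv_into V g y)) (g ` V) (h ` V)"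
    unfolding bij_betw_def
  proof
    show "inj_on (\<lambda>y. h (inv_into V g y)) (g ` V)"
      by (rule inj_onI) (metis assms f_inv_into_f inv_into_into)
    show "(\<lambda>y. h (inv_into V g y)) ` g ` V = h ` V"
    proof -
      have "h (inv_into V g (g v)) = h v" if "v \<in> V" for v
        using assms that by (metis f_inv_into_f imageI inv_into_into)
      then show ?thesis
        by (auto simp: image_image)
    qed
  qed
qed

lemma components_image: "components G F = (\<lambda>v. conn G F `` {v}) ` verts G"
  by (auto simp: components_def quotient_def)

lemma wf_ends:
  assumes "wf_cgraph k G" "e \<in> edges G"
  obtains a b where "ends G e = {a, b}" "a \<in> verts G" "b \<in> verts G"
proof -
  have sub: "ends G e \<subseteq> verts G" and "card (ends G e) = 1 \<or> card (ends G e) = 2"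
    using assms by (auto simp: wf_cgraph_def)
  then obtain a b where "ends G e = {a, b}"
    by (metis card_1_singletonE card_2_iff insert_absorb2)
  with sub that show thesis
    by auto
qed

lemma wf_finite: "wf_cgraph k G \<Longrightarrow> finite (verts G)"
  by (simp add: wf_cgraph_def)

text \<open>The propositional core of the next lemma. The right-hand side spells out equality under
  the map that sends the class of \<open>b\<close> to that of \<open>a\<close> and fixes all other
  classes.\<close>

lemma merge_classes:
  assumes s: "\<And>x y. R x y \<Longrightarrow> R y x" and t: "\<And>x y z. R x y \<Longrightarrow> R y z \<Longrightarrow> R x z"
    and n: "\<not> R a b"
  shows "R u v \<or> R u a \<and> R b v \<or> R u b \<and> R a v \<longleftrightarrow>
    (if R u b then if R v b then True else R a v else if R v b then R u a else R u v)"
proof (cases "R u b")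
  case ub: True
  show ?thesis
  proof (cases "R v b")
    case True
    then have "R u v" using ub s t by blast
    with ub True show ?thesis by simp
  next
    case False
    then have "\<not> R u v" "\<not> R u a" using ub n s t by blast+
    with ub False show ?thesis by simp
  qed
next
  case ub: False
  show ?thesis
  proof (cases "R v b")
    case True
    then have "\<not> R u v" "R b v" using ub s t by blast+
    with ub True show ?thesis by simp
  next
    case False
    then have "\<not> R b v" using s by blast
    with ub False show ?thesis by simp
  qed
qed

lemma card_components_insert:
  assumes wf: "wf_cgraph k G" and e: "ends G e = {a, b}" "a \<in> verts G" "b \<in> verts G"
    and nc: "(a, b) \<notin> conn G F"
  shows "card (components G F) = card (components G (insert e F)) + 1"
proof -
  define h where "h v = (if (v, b) \<in> conn G F then conn G F `` {a} else conn G F `` {v})" for v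
  have "card (components G (insert e F)) = card (h ` verts G)"
    unfolding components_image
  proof (rule card_image_kernel)
    fix u v assume "u \<in> verts G" "v \<in> verts G"
    have h: "h u = h v \<longleftrightarrow>
        (if (u, b) \<in> conn G F then if (v, b) \<in> conn G F then True else (a, v) \<in> conn G F
         else if (v, b) \<in> conn G F then (u, a) \<in> conn G F else (u, v) \<in> conn G F)"
      by (simp add: h_def conn_class_eq)
    have "(u, v) \<in> conn G (insert e F) \<longleftrightarrow> (u, v) \<in> conn G F \<or>
        (u, a) \<in> conn G F \<and> (b, v) \<in> conn G F \<or> (u, b) \<in> conn G F \<and> (a, v) \<in> conn G F"
      unfolding conn_insert e(1) by (auto simp: doubleton_eq_iff)
    also have "\<dots> \<longleftrightarrow> h u = h v"
      unfolding h
      by (rule merge_classes[where R = "\<lambda>x y. (x, y) \<in> conn G F", OF conn_sym rtrancl_trans nc])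
    finally show "conn G (insert e F) `` {u} = conn G (insert e F) `` {v} \<longleftrightarrow> h u = h v"
      unfolding conn_class_eq .
  qed
  \<comment> \<open>Since \<open>a\<close> and \<open>b\<close> were not joined before, exactly the
    class of \<open>b\<close> is lost.\<close>
  also have "h ` verts G = components G F - {conn G F `` {b}}"
  proof -
    have "h v \<in> components G F - {conn G F `` {b}}" if "v \<in> verts G" for v
      using that e nc by (auto simp: h_def components_image conn_class_eq)
    moreover have "C \<in> h ` verts G" if C: "C \<in> components G F - {conn G F `` {b}}" for C
    proof -
      from C obtain v where v: "v \<in> verts G" "C = conn G F `` {v}"
        by (auto simp: components_image)
      with C have "(v, b) \<notin> conn G F"
        by (auto simp: conn_class_eq)
      with v have "C = h v"
        by (simp add: h_def)
      with v show ?thesis by auto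
    qed
    ultimately show ?thesis by auto
  qed
  also have "card \<dots> = card (components G F) - 1"
    using e by (intro card_Diff_singleton) (auto simp: components_image)
  finally have "card (components G (insert e F)) = card (components G F) - 1" .
  moreover have "card (components G F) > 0"
    using e wf_finite[OF wf] by (auto simp: components_image card_gt_0_iff)
  ultimately show ?thesis
    by simp
qed

text \<open>A new edge either closes a cycle or merges two components. In the second case the
  additional edge and the lost component cancel.\<close>

lemma betti_insert:
  fixes G :: "'c::finite cgraph"
  assumes wf: "wf_cgraph k G" and e: "e \<in> edges G" "e \<notin> F" and ab: "ends G e = {a, b}"
  shows "betti G (insert e F) = betti G F + (if (a, b) \<in> conn G F then 1 else 0)"
proof (cases "(a, b) \<in> conn G F")
  case True
  then show ?thesis
    using e by (simp add: betti_def components_def conn_insert_redundant[OF ab])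
next
  case False
  have "a \<in> verts G" "b \<in> verts G"
    using wf e ab by (auto simp: wf_cgraph_def)
  from card_components_insert[OF wf ab this False] False e show ?thesis
    by (simp add: betti_def)
qed

lemma betti_empty: "betti G {} = 0"
proof -
  have "card (components G {}) = card (id ` verts G)"
    unfolding components_image
    by (rule card_image_kernel) (simp add: conn_class_eq adjacent_def)
  then show ?thesis
    by (simp add: betti_def)
qed

lemma betti_mono:
  fixes G :: "'c::finite cgraph"
  assumes wf: "wf_cgraph k G" and "A \<subseteq> B" "B \<subseteq> edges G"
  shows "betti G A \<le> betti G B"
proof -
  have "finite (B - A)" by simp
  then have "D \<subseteq> edges G \<Longrightarrow> betti G A \<le> betti G (A \<union> D)" if "D \<subseteq> B - A" for D
    using that
  proof (induction D rule: infinite_finite_induct)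
    case (insert e D)
    obtain a b where ab: "ends G e = {a, b}"
      using wf_ends[OF wf, of e] insert.prems by (meson insert_subset)
    have "betti G (insert e (A \<union> D)) \<ge> betti G (A \<union> D)"
      using betti_insert[OF wf _ _ ab, of "A \<union> D"] insert by auto
    with insert show ?case by auto
  qed auto
  from this[of "B - A"] assms show ?thesis
    by (auto simp: Un_absorb1)
qed

section \<open>Forests, paths in forests and spanning trees\<close>

lemma forest_subset:
  fixes G :: "'c::finite cgraph"
  assumes wf: "wf_cgraph k G" and "forest G T" "A \<subseteq> T"
  shows "forest G A"
  using assms betti_mono[OF wf, of A T] betti_mono[OF wf, of "{}" A]
  by (auto simp: forest_def betti_empty)

lemma forest_edge_not_conn:
  fixes G :: "'c::finite cgraph"
  assumes wf: "wf_cgraph k G" and T: "forest G T" "e \<in> T" "ends G e = {a, b}"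
  shows "(a, b) \<notin> conn G (T - {e})"
proof -
  have "forest G (T - {e})"
    using forest_subset[OF wf] T by blast
  moreover have "betti G (insert e (T - {e})) = betti G (T - {e}) + (if (a, b) \<in> conn G (T - {e}) then 1 else 0)"
    using T by (intro betti_insert[OF wf]) (auto simp: forest_def)
  ultimately show ?thesis
    using T by (auto simp: forest_def insert_absorb)
qed

text \<open>A forest that is maximal among those containing \<open>F\<close> works: an edge whose
  ends it does not join could be added without raising the Betti number.\<close>

lemma spanning_tree_extension:
  fixes G :: "'c::finite cgraph"
  assumes wf: "wf_cgraph k G" and con: "graph_connected G (edges G)" and F: "forest G F"
  obtains T where "T \<in> spanning_trees G" "F \<subseteq> T"
proof -
  have "finite {T. forest G T \<and> F \<subseteq> T}" "F \<in> {T. forest G T \<and> F \<subseteq> T}"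
    using F by auto
  from finite_has_maximal2[OF this] obtain T where T: "forest G T" "F \<subseteq> T"
    and max: "\<And>T'. forest G T' \<Longrightarrow> F \<subseteq> T' \<Longrightarrow> T \<subseteq> T' \<Longrightarrow> T = T'"
    by auto
  have adj: "(a, b) \<in> conn G T" if e: "e \<in> edges G" "ends G e = {a, b}" for e a b
  proof (cases "e \<in> T")
    case True
    with e show ?thesis by (intro conn_edge)
  next
    case False
    show ?thesis
    proof (rule ccontr)
      assume "(a, b) \<notin> conn G T"
      then have "forest G (insert e T)"
        using betti_insert[OF wf e(1) False e(2)] T e by (auto simp: forest_def)
      with max[of "insert e T"] T False show False by auto
    qed
  qed
  have "adjacent G (edges G) \<subseteq> conn G T"
    using adj by (auto simp: adjacent_def)
  then have "conn G (edges G) \<subseteq> conn G T"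
    using rtrancl_subset_rtrancl by blast
  with con T have "T \<in> spanning_trees G"
    by (auto simp: spanning_trees_def graph_connected_def)
  with T that show thesis by blast
qed

text \<open>Paths in forests are unique. If every path in \<open>A\<close> needed \<open>e\<close>,
  a connection in \<open>T\<close> avoiding \<open>e\<close> would close a cycle through
  \<open>e\<close>.\<close>

lemma forest_conn_Diff1:
  fixes G :: "'c::finite cgraph"
  assumes wf: "wf_cgraph k G" and T: "forest G T" "A \<subseteq> T"
    and uv: "(u, v) \<in> conn G A" "(u, v) \<in> conn G (T - {e})"
  shows "(u, v) \<in> conn G (A - {e})"
proof (rule ccontr)
  assume n: "(u, v) \<notin> conn G (A - {e})"
  with uv have e: "e \<in> A" by (cases "e \<in> A") auto
  with uv have "(u, v) \<in> conn G (insert e (A - {e}))"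
    by (simp add: insert_absorb)
  with n obtain a b where ab: "ends G e = {a, b}" "(u, a) \<in> conn G (A - {e})" "(b, v) \<in> conn G (A - {e})"
    using conn_insert by metis
  have "conn G (A - {e}) \<subseteq> conn G (T - {e})"
    using T by (intro conn_mono) auto
  with ab uv have "(a, b) \<in> conn G (T - {e})"
    by (meson conn_sym rtrancl_trans subsetD)
  with forest_edge_not_conn[OF wf T(1) subsetD[OF T(2) e] ab(1)] show False by contradiction
qed

text \<open>Edges that individually do not separate \<open>u\<close> from \<open>v\<close> lie off
  the unique path between them, so they can be deleted simultaneously. In graphs with cycles this
  fails.\<close>

lemma forest_conn_Diff:
  fixes G :: "'c::finite cgraph"
  assumes wf: "wf_cgraph k G" and T: "forest G T" and uv: "(u, v) \<in> conn G T"
    and D: "\<And>e. e \<in> D \<Longrightarrow> (u, v) \<in> conn G (T - {e})"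
  shows "(u, v) \<in> conn G (T - D)"
proof -
  have "finite D" by simp
  then have "(\<forall>e\<in>D. (u, v) \<in> conn G (T - {e})) \<longrightarrow> (u, v) \<in> conn G (T - D)"
  proof (induction D rule: finite_induct)
    case empty
    show ?case using uv Diff_empty[of T] by metis
  next
    case (insert e D)
    show ?case
    proof
      assume e: "\<forall>e\<in>insert e D. (u, v) \<in> conn G (T - {e})"
      with insert.IH have "(u, v) \<in> conn G (T - D)"
        by blast
      moreover from e have "(u, v) \<in> conn G (T - {e})"
        by blast
      ultimately have "(u, v) \<in> conn G (T - D - {e})"
        using forest_conn_Diff1[OF wf T Diff_subset] by blast
      then show "(u, v) \<in> conn G (T - insert e D)"
        by (metis Diff_insert)
    qed
  qed
  with D show ?thesis
    by blast
qed

lemma card_components_spanning_tree: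
  assumes wf: "wf_cgraph k G" and T: "graph_connected G T"
  shows "card (components G T) = 1"
proof -
  have "card (components G T) = card ((\<lambda>_. ()) ` verts G)"
    unfolding components_image
    by (rule card_image_kernel) (use T in \<open>auto simp: conn_class_eq graph_connected_def\<close>)
  also have "(\<lambda>_. ()) ` verts G = {()}"
    using wf unfolding wf_cgraph_def by blast
  finally show ?thesis
    by simp
qed

text \<open>The Betti number stays \<open>0\<close> while one edge is lost, so the number of
  components grows from \<open>1\<close> to \<open>2\<close>.\<close>

lemma spanning_tree_remove_edge:
  fixes G :: "'c::finite cgraph"
  assumes wf: "wf_cgraph k G" and T: "T \<in> spanning_trees G" and e: "e \<in> T"
  shows "T - {e} \<in> spanning_2_forests G"
proof -
  have f: "forest G T" and c: "card (components G T) = 1"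
    using T card_components_spanning_tree[OF wf] by (auto simp: spanning_trees_def)
  have "forest G (T - {e})"
    using forest_subset[OF wf f] by blast
  moreover have "card T = card (T - {e}) + 1"
    using e by (metis Suc_eq_plus1 card_Suc_Diff1 finite)
  with calculation f c have "card (components G (T - {e})) = 2"
    by (simp add: forest_def betti_def)
  ultimately show ?thesis
    by (auto simp: spanning_2_forests_def)
qed

section \<open>Momenta of spanning 2-forests\<close>

text \<open>The coefficient of the monomial of \<open>T\<close> in \<open>phi\<close>, still with an
  arbitrary choice of component; \<open>momentum_square_eq\<close> removes the choice.\<close>

definition momentum_square ::
  "((real ^ 'd::finite) \<Rightarrow> real) \<Rightarrow> nat \<Rightarrow> (nat \<Rightarrow> (real ^ 'd)) \<Rightarrow> 'c cgraph \<Rightarrow> 'c set \<Rightarrow> real" where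
  "momentum_square q k p G T =
     q (\<Sum>i\<in>{i\<in>{1..k}. leg G i \<in> (SOME A. A \<in> components G T)}. p i)"

lemma phi_alt:
  "phi q k p G x = (\<Sum>T\<in>spanning_2_forests G. momentum_square q k p G T * (\<Prod>e\<in>edges G - T. x $ e))"
  by (simp add: phi_def momentum_square_def Let_def)

lemma spacetime_form_zero: "spacetime_form q \<Longrightarrow> q 0 = 0"
  by (auto simp: spacetime_form_def minkowski_form_def)

lemma spacetime_form_minus: "spacetime_form q \<Longrightarrow> q (- v) = q v"
  by (auto simp: spacetime_form_def minkowski_form_def)

lemma components_disjoint:
  "A \<in> components G T \<Longrightarrow> B \<in> components G T \<Longrightarrow> A \<noteq> B \<Longrightarrow> A \<inter> B = {}"
proof -
  assume "A \<in> components G T" "B \<in> components G T" and ne: "A \<noteq> B"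
  then obtain u v where A: "A = conn G T `` {u}" and B: "B = conn G T `` {v}"
    unfolding components_image by blast
  have "False" if "w \<in> A" "w \<in> B" for w
  proof -
    have "(u, w) \<in> conn G T" "(v, w) \<in> conn G T"
      using that A B by blast+
    then have "(u, v) \<in> conn G T"
      by (meson conn_sym rtrancl_trans)
    with ne A B show False
      using conn_class_eq by blast
  qed
  then show "A \<inter> B = {}"
    by blast
qed

text \<open>By momentum conservation the momenta of the two components are opposite, and
  \<open>q\<close> is even.\<close>

lemma momentum_square_eq:
  assumes wf: "wf_cgraph k G" and q: "spacetime_form q" and p: "generic_momenta q k p"
    and c: "card (components G T) = 2" and A: "A \<in> components G T"
  shows "momentum_square q k p G T = q (\<Sum>i\<in>{i\<in>{1..k}. leg G i \<in> A}. p i)"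
proof -
  define B where "B = (SOME A. A \<in> components G T)"
  have B: "B \<in> components G T"
    unfolding B_def using A by (metis someI)
  show ?thesis
  proof (cases "A = B")
    case False
    with A B c have AB: "components G T = {A, B}"
      by (metis card_2_iff doubleton_eq_iff insertE singletonD)
    have "leg G i \<in> A \<union> B" if "i \<in> {1..k}" for i
    proof -
      have "leg G i \<in> verts G"
        using wf that by (auto simp: wf_cgraph_def)
      then have "conn G T `` {leg G i} \<in> components G T"
        by (auto simp: components_image)
      then show ?thesis
        unfolding AB by auto
    qed
    then have un: "{1..k} = {i\<in>{1..k}. leg G i \<in> A} \<union> {i\<in>{1..k}. leg G i \<in> B}"
      by blast
    let ?A = "{i\<in>{1..k}. leg G i \<in> A}" and ?B = "{i\<in>{1..k}. leg G i \<in> B}"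
    have "?A \<inter> ?B = {}"
      using components_disjoint[OF A B False] by blast
    then have "sum p (?A \<union> ?B) = sum p ?A + sum p ?B"
      by (intro sum.union_disjoint) simp_all
    moreover have "sum p {1..k} = 0"
      using p unfolding generic_momenta_def by (rule conjunct1)
    ultimately have "sum p ?A + sum p ?B = 0"
      using un by metis
    then have "sum p ?B = - sum p ?A"
      by (rule minus_unique[symmetric])
    then have "q (sum p ?B) = q (sum p ?A)"
      by (simp only: spacetime_form_minus[OF q])
    then show ?thesis
      unfolding momentum_square_def B_def[symmetric] .
  qed (simp add: momentum_square_def B_def)
qed

text \<open>Genericity covers proper nonempty sets of legs. For no legs and for all legs the total
  momentum is \<open>0\<close>.\<close>

lemma momentum_square_nonneg:
  assumes q: "spacetime_form q" and p: "generic_momenta q k p"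
  shows "momentum_square q k p G T \<ge> 0"
proof -
  define I where "I = {i\<in>{1..k}. leg G i \<in> (SOME A. A \<in> components G T)}"
  have "I \<subseteq> {1..k}"
    by (auto simp: I_def)
  then consider "I = {}" | "I = {1..k}" | "I \<noteq> {}" "I \<subset> {1..k}"
    by blast
  then have "q (\<Sum>i\<in>I. p i) \<ge> 0"
    by cases (use p spacetime_form_zero[OF q] in \<open>auto simp: generic_momenta_def less_imp_le\<close>)
  then show ?thesis
    by (simp add: momentum_square_def I_def)
qed

text \<open>The chosen component carries either no leg or every leg, and in both cases its momentum
  vanishes.\<close>

lemma momentum_square_eq_0:
  assumes q: "spacetime_form q" and p: "generic_momenta q k p"
    and c: "card (components G T) = 2"
    and legs: "\<And>i j. i \<in> {1..k} \<Longrightarrow> j \<in> {1..k} \<Longrightarrow> (leg G i, leg G j) \<in> conn G T"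
  shows "momentum_square q k p G T = 0"
proof -
  define A where "A = (SOME A. A \<in> components G T)"
  have "components G T \<noteq> {}" using c by auto
  then have "A \<in> components G T"
    unfolding A_def by (simp add: some_in_eq)
  then obtain v where v: "A = conn G T `` {v}"
    by (auto simp: components_image)
  have step: "leg G j \<in> A" if "leg G i \<in> A" "i \<in> {1..k}" "j \<in> {1..k}" for i j
  proof -
    have "(v, leg G i) \<in> conn G T"
      using that v by blast
    then show ?thesis
      using rtrancl_trans[OF _ legs[OF that(2,3)]] v by blast
  qed
  have "(\<Sum>i\<in>{i\<in>{1..k}. leg G i \<in> A}. p i) = 0"
  proof (cases "\<exists>i\<in>{1..k}. leg G i \<in> A")
    case True
    then have "{i\<in>{1..k}. leg G i \<in> A} = {1..k}"
      using step by blast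
    moreover have "(\<Sum>i\<in>{1..k}. p i) = 0"
      using p unfolding generic_momenta_def by (rule conjunct1)
    ultimately show ?thesis
      by simp
  next
    case False
    then have "{i\<in>{1..k}. leg G i \<in> A} = {}"
      by blast
    then show ?thesis
      by (simp only: sum.empty)
  qed
  then show ?thesis
    unfolding momentum_square_def A_def[symmetric] by (simp only: spacetime_form_zero[OF q])
qed

text \<open>The component of leg \<open>i\<close> misses leg \<open>j\<close>, so its legs form a
  proper nonempty set, to which genericity applies.\<close>

lemma momentum_square_pos:
  assumes wf: "wf_cgraph k G" and q: "spacetime_form q" and p: "generic_momenta q k p"
    and c: "card (components G T) = 2"
    and ij: "i \<in> {1..k}" "j \<in> {1..k}" "(leg G i, leg G j) \<notin> conn G T"
  shows "momentum_square q k p G T > 0"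
proof -
  have "leg G i \<in> verts G"
    using wf ij by (auto simp: wf_cgraph_def)
  then have A: "conn G T `` {leg G i} \<in> components G T"
    by (auto simp: components_image)
  let ?I = "{l\<in>{1..k}. leg G l \<in> conn G T `` {leg G i}}"
  have "i \<in> ?I" "j \<in> {1..k} - ?I"
    using ij by auto
  then have "?I \<noteq> {} \<and> ?I \<subset> {1..k}"
    by blast
  moreover have "\<forall>I. I \<noteq> {} \<and> I \<subset> {1..k} \<longrightarrow> q (\<Sum>i\<in>I. p i) > 0"
    using p unfolding generic_momenta_def by (rule conjunct2)
  ultimately have "q (\<Sum>i\<in>?I. p i) > 0"
    by metis
  with momentum_square_eq[OF wf q p c A] show ?thesis
    by metis
qed

section \<open>Contractions and isomorphisms\<close>

text \<open>
  \<open>f\<close> exhibits \<open>H\<close> as \<open>G/F\<close>. Isomorphisms are the special case \<open>F = {}\<close>, so the invariance of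
  the integrand under isomorphisms and its compatibility with contractions are proved together.
\<close>

definition collapses ::
  "nat \<Rightarrow> 'c::finite cgraph \<Rightarrow> 'c set \<Rightarrow> 'c cgraph \<Rightarrow> (nat \<Rightarrow> nat) \<Rightarrow> bool" where
  "collapses k G F H f \<longleftrightarrow> wf_cgraph k G \<and> forest G F \<and> f ` verts G = verts H \<and>
     edges H = edges G - F \<and> (\<forall>e\<in>edges H. ends H e = f ` ends G e) \<and>
     (\<forall>u\<in>verts G. \<forall>v\<in>verts G. f u = f v \<longleftrightarrow> (u, v) \<in> conn G F) \<and>
     (\<forall>i\<in>{1..k}. leg H i = f (leg G i))"

lemma component_rep_eq: "component_rep G F u = component_rep G F v \<longleftrightarrow> (u, v) \<in> conn G F"
proof
  have rep: "(w, component_rep G F w) \<in> conn G F" for w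
    unfolding component_rep_def by (rule LeastI) (rule rtrancl.rtrancl_refl)
  assume "component_rep G F u = component_rep G F v"
  with rep[of u] conn_sym[OF rep[of v]] show "(u, v) \<in> conn G F"
    using rtrancl_trans by metis
next
  assume "(u, v) \<in> conn G F"
  then have "conn G F `` {u} = conn G F `` {v}"
    by (simp only: conn_class_eq)
  then have "(u, w) \<in> conn G F \<longleftrightarrow> (v, w) \<in> conn G F" for w
    by blast
  then show "component_rep G F u = component_rep G F v"
    by (simp only: component_rep_def)
qed

lemma collapses_contract:
  "wf_cgraph k G \<Longrightarrow> forest G F \<Longrightarrow> collapses k G F (contract G F) (component_rep G F)"
  unfolding collapses_def by (simp add: contract_def component_rep_eq)

lemma adjacent_empty: "adjacent G {} = {}"
  by (simp add: adjacent_def)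

lemma collapses_isomorphic:
  assumes "wf_cgraph k G" "isomorphic k G H"
  obtains g where "collapses k G {} H g"
proof -
  from assms(2) obtain g where g: "edges G = edges H" "bij_betw g (verts G) (verts H)"
      "\<forall>e\<in>edges G. ends H e = g ` ends G e" "\<forall>i\<in>{1..k}. leg H i = g (leg G i)"
    unfolding isomorphic_def by blast
  then have "collapses k G {} H g"
    using assms(1) unfolding collapses_def bij_betw_def
    by (auto simp: forest_def betti_empty adjacent_empty inj_on_eq_iff)
  with that show thesis .
qed

text \<open>Paths in \<open>G\<close> project to \<open>H\<close>, edges of \<open>F\<close>
  becoming stationary. Conversely, an edge of \<open>H\<close> lifts to \<open>G\<close>, and
  consecutive lifts are linked inside a fibre of \<open>f\<close>, which is connected by
  \<open>F\<close>.\<close>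

lemma conn_collapse:
  assumes c: "collapses k G F H f" and F': "F' \<subseteq> edges H" and u: "u \<in> verts G" and v: "v \<in> verts G"
  shows "(f u, f v) \<in> conn H F' \<longleftrightarrow> (u, v) \<in> conn G (F \<union> F')"
proof -
  have wf: "wf_cgraph k G" and F: "F \<subseteq> edges G" and im: "f ` verts G = verts H"
    and F'G: "F' \<subseteq> edges G"
    and ends: "\<And>e. e \<in> F' \<Longrightarrow> ends H e = f ` ends G e"
    and ker: "\<And>u v. u \<in> verts G \<Longrightarrow> v \<in> verts G \<Longrightarrow> f u = f v \<longleftrightarrow> (u, v) \<in> conn G F"
    using c F' by (auto simp: collapses_def forest_def)
  have vert: "a \<in> verts G \<and> b \<in> verts G" if "e \<in> edges G" "ends G e = {a, b}" for e a b
    using wf that unfolding wf_cgraph_def by blast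
  show ?thesis
  proof
    assume "(u, v) \<in> conn G (F \<union> F')"
    then have "(f u, f v) \<in> conn H F'"
    proof (induction rule: rtrancl_induct)
      case (step y z)
      then obtain e where e: "e \<in> F \<union> F'" "ends G e = {y, z}"
        unfolding adjacent_def by blast
      then have yz: "y \<in> verts G" "z \<in> verts G"
        using vert F F'G by blast+
      have "(f y, f z) \<in> conn H F'"
      proof (cases "e \<in> F")
        case True
        then have "f y = f z"
          using ker[OF yz] conn_edge[OF True e(2)] by blast
        then show ?thesis by simp
      next
        case False
        then have "e \<in> F'" using e by blast
        then show ?thesis
          using ends e by (intro conn_edge[of e]) auto
      qed
      with step.IH show ?case
        by (rule rtrancl_trans)
    qed (rule rtrancl.rtrancl_refl)
    then show "(f u, f v) \<in> conn H F'" .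
  next
    have sub: "conn G F \<subseteq> conn G (F \<union> F')"
      by (rule conn_mono) blast
    \<comment> \<open>The induction has to reach all preimages of \<open>y\<close>, since the lift
      of the next edge may start at any of them.\<close>
    have "\<forall>w\<in>verts G. f w = y \<longrightarrow> (u, w) \<in> conn G (F \<union> F')" if "(f u, y) \<in> conn H F'" for y
      using that
    proof (induction rule: rtrancl_induct)
      case base
      show ?case
        using ker[OF u] sub by (metis subsetD)
    next
      case (step y z)
      then obtain e where e: "e \<in> F'" "ends H e = {y, z}"
        unfolding adjacent_def by blast
      obtain a b where ab: "ends G e = {a, b}" "a \<in> verts G" "b \<in> verts G"
        using wf_ends[OF wf, of e] e F'G by blast
      have "{f a, f b} = {y, z}"
        using ends[OF e(1)] e ab by simp
      then obtain a b where ab: "ends G e = {a, b}" "a \<in> verts G" "b \<in> verts G" "f a = y" "f b = z"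
        using ab by (metis doubleton_eq_iff insert_commute)
      have ua: "(u, a) \<in> conn G (F \<union> F')"
        using step.IH ab by blast
      have "(a, b) \<in> conn G (F \<union> F')"
        using e ab by (intro conn_edge[of e]) auto
      with ua have ub: "(u, b) \<in> conn G (F \<union> F')"
        by (rule rtrancl_trans)
      show ?case
      proof (intro ballI impI)
        fix w assume w: "w \<in> verts G" "f w = z"
        then have "(b, w) \<in> conn G F"
          using ker[of b w] ab by metis
        with sub have "(b, w) \<in> conn G (F \<union> F')"
          by (rule subsetD)
        with ub show "(u, w) \<in> conn G (F \<union> F')"
          by (rule rtrancl_trans)
      qed
    qed
    then show "(f u, f v) \<in> conn H F' \<Longrightarrow> (u, v) \<in> conn G (F \<union> F')"
      using v by blast
  qed
qed

lemma card_components_collapse: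
  assumes c: "collapses k G F H f" and F': "F' \<subseteq> edges H"
  shows "card (components H F') = card (components G (F \<union> F'))"
proof -
  have "f ` verts G = verts H"
    using c by (simp add: collapses_def)
  then have "components H F' = (\<lambda>v. conn H F' `` {f v}) ` verts G"
    by (simp add: components_image image_image flip: \<open>f ` verts G = verts H\<close>)
  also have "card \<dots> = card (components G (F \<union> F'))"
    unfolding components_image
    by (rule card_image_kernel) (simp only: conn_class_eq conn_collapse[OF c F'])
  finally show ?thesis .
qed

text \<open>The vertices of \<open>H\<close> are the components of \<open>F\<close>. As
  \<open>F\<close> has Betti number \<open>0\<close>, there are \<open>card F\<close> fewer of them
  than vertices of \<open>G\<close>, which compensates for the missing edges.\<close>

lemma betti_collapse:
  assumes c: "collapses k G F H f" and F': "F' \<subseteq> edges H"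
  shows "betti H F' = betti G (F \<union> F')"
proof -
  have F: "betti G F = 0" and im: "f ` verts G = verts H" and dis: "F \<inter> F' = {}"
    and ker: "\<And>u v. u \<in> verts G \<Longrightarrow> v \<in> verts G \<Longrightarrow> f u = f v \<longleftrightarrow> (u, v) \<in> conn G F"
    using c F' by (auto simp: collapses_def forest_def)
  have "card (f ` verts G) = card (components G F)"
    unfolding components_image
    by (rule card_image_kernel) (simp only: conn_class_eq ker)
  then have V: "card (verts H) = card (components G F)"
    by (simp add: im)
  have "card (F \<union> F') = card F + card F'"
    using dis by (intro card_Un_disjoint) auto
  then show ?thesis
    using F by (simp add: betti_def V card_components_collapse[OF c F'])
qed

lemma forest_collapse:
  assumes c: "collapses k G F H f" and F': "F' \<subseteq> edges H"
  shows "forest H F' \<longleftrightarrow> forest G (F \<union> F')"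
  using F' c by (auto simp: forest_def betti_collapse[OF c F'] collapses_def)

lemma graph_connected_collapse:
  assumes c: "collapses k G F H f" and F': "F' \<subseteq> edges H"
  shows "graph_connected H F' \<longleftrightarrow> graph_connected G (F \<union> F')"
proof -
  have "verts H = f ` verts G"
    using c by (simp add: collapses_def)
  then show ?thesis
    by (simp add: graph_connected_def conn_collapse[OF c F'])
qed

lemma spanning_tree_collapse:
  assumes c: "collapses k G F H f" and F': "F' \<subseteq> edges H"
  shows "F' \<in> spanning_trees H \<longleftrightarrow> F \<union> F' \<in> spanning_trees G"
  by (simp add: spanning_trees_def forest_collapse[OF c F'] graph_connected_collapse[OF c F'])

lemma spanning_2_forest_collapse:
  assumes c: "collapses k G F H f" and F': "F' \<subseteq> edges H"
  shows "F' \<in> spanning_2_forests H \<longleftrightarrow> F \<union> F' \<in> spanning_2_forests G"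
  by (simp add: spanning_2_forests_def forest_collapse[OF c F'] card_components_collapse[OF c F'])

lemma collapses_wf:
  assumes c: "collapses k G F H f"
  shows "wf_cgraph k H"
proof -
  have wf: "wf_cgraph k G" and H: "verts H = f ` verts G" "edges H = edges G - F"
    "\<forall>e\<in>edges H. ends H e = f ` ends G e" "\<forall>i\<in>{1..k}. leg H i = f (leg G i)"
    using c by (auto simp: collapses_def)
  have "ends H e \<subseteq> verts H \<and> card (ends H e) \<in> {1, 2}" if e: "e \<in> edges H" for e
  proof -
    obtain a b where "ends G e = {a, b}" "a \<in> verts G" "b \<in> verts G"
      using wf_ends[OF wf, of e] e H by blast
    with e H have "ends H e = {f a, f b}" "f a \<in> verts H" "f b \<in> verts H"
      by auto
    then show ?thesis
      by (simp add: card_insert_if)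
  qed
  moreover have "leg H i \<in> verts H" if "i \<in> {1..k}" for i
    using that wf H by (auto simp: wf_cgraph_def)
  ultimately show ?thesis
    using wf H(1) by (auto simp: wf_cgraph_def)
qed

text \<open>The components selected in \<open>H\<close> and in \<open>G\<close> may be unrelated.
  Both are replaced by components of corresponding vertices \<open>f v\<close> and \<open>v\<close>,
  which carry the same legs.\<close>

lemma momentum_square_collapse:
  assumes c: "collapses k G F H f" and F': "F' \<subseteq> edges H"
    and q: "spacetime_form q" and p: "generic_momenta q k p"
    and two: "card (components H F') = 2"
  shows "momentum_square q k p H F' = momentum_square q k p G (F \<union> F')"
proof -
  have wf: "wf_cgraph k G" and im: "verts H = f ` verts G" and F: "F \<subseteq> edges G" "F' \<subseteq> edges G"
    and legs: "\<And>i. i \<in> {1..k} \<Longrightarrow> leg H i = f (leg G i)"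
    using c F' by (auto simp: collapses_def forest_def)
  have legG: "leg G i \<in> verts G" if "i \<in> {1..k}" for i
    using wf that by (simp add: wf_cgraph_def)
  obtain v where v: "v \<in> verts G"
    using wf by (auto simp: wf_cgraph_def)
  have "momentum_square q k p H F' = q (\<Sum>i\<in>{i\<in>{1..k}. leg H i \<in> conn H F' `` {f v}}. p i)"
    using v im by (intro momentum_square_eq[OF collapses_wf[OF c] q p two]) (simp add: components_image)
  also have "{i\<in>{1..k}. leg H i \<in> conn H F' `` {f v}} = {i\<in>{1..k}. leg G i \<in> conn G (F \<union> F') `` {v}}"
    using conn_collapse[OF c F' v] legs legG by auto
  also have "q (\<Sum>i\<in>\<dots>. p i) = momentum_square q k p G (F \<union> F')"
    using v two
    by (intro momentum_square_eq[OF wf q p, symmetric])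
      (simp_all add: card_components_collapse[OF c F'] components_image[of G])
  finally show ?thesis .
qed

text \<open>Index sets and coefficients are kept abstract, so that the argument serves
  \<open>psi\<close>, with all coefficients \<open>1\<close>, as well as \<open>phi\<close>.\<close>

lemma sum_forests_collapse:
  fixes x :: "real ^ 'c::finite"
  assumes zero: "\<And>e. e \<in> F \<Longrightarrow> x $ e = 0" and F: "F \<subseteq> E"
    and A: "\<And>T. T \<in> A \<Longrightarrow> T \<subseteq> E" and B: "\<And>T. T \<in> B \<Longrightarrow> T \<subseteq> E - F"
    and AB: "\<And>T. T \<subseteq> E - F \<Longrightarrow> T \<in> B \<longleftrightarrow> F \<union> T \<in> A"
    and c: "\<And>T. T \<in> B \<Longrightarrow> b T = a (F \<union> T)"
  shows "(\<Sum>T\<in>B. b T * (\<Prod>e\<in>E - F - T. x $ e)) = (\<Sum>T\<in>A. a T * (\<Prod>e\<in>E - T. x $ e))"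
proof -
  have "(\<Sum>T\<in>A. a T * (\<Prod>e\<in>E - T. x $ e)) = (\<Sum>T\<in>{T\<in>A. F \<subseteq> T}. a T * (\<Prod>e\<in>E - T. x $ e))"
  proof (rule sum.mono_neutral_right)
    show "\<forall>T\<in>A - {T \<in> A. F \<subseteq> T}. a T * (\<Prod>e\<in>E - T. x $ e) = 0"
    proof
      fix T assume "T \<in> A - {T \<in> A. F \<subseteq> T}"
      then obtain e where "e \<in> F" "e \<notin> T" by auto
      with F zero have "(\<Prod>e\<in>E - T. x $ e) = 0"
        by (intro prod_zero) auto
      then show "a T * (\<Prod>e\<in>E - T. x $ e) = 0" by simp
    qed
  qed auto
  also have "\<dots> = (\<Sum>T\<in>B. b T * (\<Prod>e\<in>E - F - T. x $ e))"
  proof (rule sum.reindex_bij_witness[where i = "\<lambda>T. F \<union> T" and j = "\<lambda>T. T - F"])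
    fix T assume T: "T \<in> {T \<in> A. F \<subseteq> T}"
    then have eq: "F \<union> (T - F) = T" by auto
    then show "F \<union> (T - F) = T" .
    show TB: "T - F \<in> B"
      using T A eq AB[of "T - F"] by auto
    have "E - F - (T - F) = E - T"
      using T by auto
    then show "b (T - F) * (\<Prod>e\<in>E - F - (T - F). x $ e) = a T * (\<Prod>e\<in>E - T. x $ e)"
      using c[OF TB] eq by simp
  next
    fix T assume T: "T \<in> B"
    then show "F \<union> T - F = T" using B by blast
    show "F \<union> T \<in> {T \<in> A. F \<subseteq> T}"
      using AB[OF B[OF T]] T by blast
  qed
  finally show ?thesis ..
qed

lemma psi_collapse:
  assumes c: "collapses k G F H f" and x: "\<And>e. e \<in> F \<Longrightarrow> x $ e = 0"
  shows "psi H x = psi G x"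
proof -
  have E: "edges H = edges G - F" and F: "F \<subseteq> edges G"
    using c by (auto simp: collapses_def forest_def)
  have "(\<Sum>T\<in>spanning_trees H. 1 * (\<Prod>e\<in>edges G - F - T. x $ e)) =
      (\<Sum>T\<in>spanning_trees G. 1 * (\<Prod>e\<in>edges G - T. x $ e))"
    using spanning_tree_collapse[OF c]
    by (intro sum_forests_collapse x F) (auto simp: spanning_trees_def forest_def E)
  then show ?thesis
    by (simp add: psi_def E)
qed

lemma phi_collapse:
  assumes c: "collapses k G F H f" and x: "\<And>e. e \<in> F \<Longrightarrow> x $ e = 0"
    and q: "spacetime_form q" and p: "generic_momenta q k p"
  shows "phi q k p H x = phi q k p G x"
proof -
  have E: "edges H = edges G - F" and F: "F \<subseteq> edges G"
    using c by (auto simp: collapses_def forest_def)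
  show ?thesis
    unfolding phi_alt E
  proof (intro sum_forests_collapse x F)
    fix T assume "T \<in> spanning_2_forests H"
    then show "momentum_square q k p H T = momentum_square q k p G (F \<union> T)"
      by (intro momentum_square_collapse[OF c _ q p]) (auto simp: spanning_2_forests_def forest_def)
  next
    show "T \<subseteq> edges G - F \<Longrightarrow> T \<in> spanning_2_forests H \<longleftrightarrow> F \<union> T \<in> spanning_2_forests G" for T
      using spanning_2_forest_collapse[OF c] E by auto
  qed (auto simp: spanning_2_forests_def forest_def E)
qed

lemma sum_collapse:
  assumes c: "collapses k G F H f" and g: "\<And>e. e \<in> F \<Longrightarrow> g e = (0::real)"
  shows "(\<Sum>e\<in>edges H. g e) = (\<Sum>e\<in>edges G. g e)"
  using c g by (intro sum.mono_neutral_left) (auto simp: collapses_def)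

lemma Xi_collapse:
  assumes c: "collapses k G F H f" and x: "\<And>e. e \<in> F \<Longrightarrow> x $ e = 0"
    and q: "spacetime_form q" and p: "generic_momenta q k p"
  shows "Xi q k p m H x = Xi q k p m G x"
proof -
  have "(\<Sum>e\<in>edges H. (m e)\<^sup>2 * x $ e) = (\<Sum>e\<in>edges G. (m e)\<^sup>2 * x $ e)"
    by (rule sum_collapse[OF c]) (simp add: x)
  then show ?thesis
    by (simp add: Xi_def psi_collapse[OF c x] phi_collapse[OF c x q p])
qed

text \<open>The value \<open>1 / 2\<close> of \<open>heaviside\<close> at \<open>0\<close> makes
  edges of length \<open>0\<close> contribute nothing to the sum, and contracting a forest preserves
  the rank.\<close>

lemma superficial_degree_collapse:
  assumes c: "collapses k G F H f" and x: "\<And>e. e \<in> F \<Longrightarrow> x $ e = 0"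
  shows "superficial_degree d H x = superficial_degree d G x"
proof -
  have "F \<union> edges H = edges G"
    using c by (auto simp: collapses_def forest_def)
  then have "betti H (edges H) = betti G (edges G)"
    using betti_collapse[OF c subset_refl] by simp
  moreover have "(\<Sum>e\<in>edges H. 2 * heaviside (x $ e) - 1) = (\<Sum>e\<in>edges G. 2 * heaviside (x $ e) - 1)"
    by (rule sum_collapse[OF c]) (simp add: x heaviside_def)
  ultimately show ?thesis
    by (simp add: superficial_degree_def)
qed

lemma feynman_density_collapse:
  assumes "collapses k G F H f" "\<And>e. e \<in> F \<Longrightarrow> x $ e = 0"
    "spacetime_form q" "generic_momenta q k p"
  shows "feynman_density q k p m H x = feynman_density q k p m G x"
  using assms
  by (simp add: feynman_density_def psi_collapse Xi_collapse superficial_degree_collapse)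

text \<open>For a point vanishing on \<open>F\<close>, the zero edges in \<open>G\<close> are
  \<open>F\<close> together with those in \<open>H\<close>, so the two forest conditions correspond.
  Points of \<open>cell H\<close> vanish on \<open>F\<close> because \<open>F\<close> contains no
  edges of \<open>H\<close>.\<close>

lemma cell_collapse:
  assumes c: "collapses k G F H f"
  shows "cell H = {x \<in> cell G. \<forall>e\<in>F. x $ e = 0}"
proof -
  have E: "edges H = edges G - F" and F: "F \<subseteq> edges G"
    using c by (auto simp: collapses_def forest_def)
  have *: "x \<in> cell H \<longleftrightarrow> x \<in> cell G" if x: "\<And>e. e \<in> F \<Longrightarrow> x $ e = 0" for x
  proof -
    have "forest H (zero_edges H x) \<longleftrightarrow> forest G (F \<union> zero_edges H x)"
      by (rule forest_collapse[OF c]) (auto simp: zero_edges_def)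
    also have "F \<union> zero_edges H x = zero_edges G x"
      using x F by (auto simp: zero_edges_def E)
    finally have "forest H (zero_edges H x) \<longleftrightarrow> forest G (zero_edges G x)" .
    moreover have "(\<Sum>e\<in>edges H. x $ e) = (\<Sum>e\<in>edges G. x $ e)"
      by (rule sum_collapse[OF c]) (rule x)
    moreover have "(\<forall>e\<in>edges H. 0 \<le> x $ e) \<longleftrightarrow> (\<forall>e\<in>edges G. 0 \<le> x $ e)"
      using x E by (metis DiffE DiffI order_refl)
    moreover have "(\<forall>e. e \<notin> edges H \<longrightarrow> x $ e = 0) \<longleftrightarrow> (\<forall>e. e \<notin> edges G \<longrightarrow> x $ e = 0)"
      using x E by blast
    ultimately show ?thesis
      by (simp add: cell_def)
  qed
  have "x $ e = 0" if "x \<in> cell H" "e \<in> F" for x e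
    using that E by (auto simp: cell_def)
  with * show ?thesis
    by blast
qed

section \<open>The hyperplane measure\<close>

lemma hyperplane_point_nth:
  "e \<in> E - {e\<^sub>0} \<Longrightarrow> hyperplane_point E e\<^sub>0 y $ e = y e"
  by (simp add: hyperplane_point_def)

lemma measurable_hyperplane_point:
  fixes E :: "'c::finite set"
  assumes M: "\<And>e. e \<in> E - {e\<^sub>0} \<Longrightarrow> sets (M e) = sets borel"
  shows "hyperplane_point E e\<^sub>0 \<in> PiM (E - {e\<^sub>0}) M \<rightarrow>\<^sub>M borel"
proof (subst borel_measurable_euclidean_space, intro ballI)
  have comp: "(\<lambda>y. y e) \<in> borel_measurable (PiM (E - {e\<^sub>0}) M)" if "e \<in> E - {e\<^sub>0}" for e
    using measurable_component_singleton[OF that, of M] measurable_cong_sets[OF refl M[OF that]] by blast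
  fix i :: "real ^ 'c" assume "i \<in> Basis"
  then obtain e where i: "i = axis e 1"
    by (auto simp: Basis_vec_def)
  have *: "(\<lambda>y. hyperplane_point E e\<^sub>0 y $ e) \<in> borel_measurable (PiM (E - {e\<^sub>0}) M)"
  proof (cases "e = e\<^sub>0")
    case True
    have "(\<lambda>y. 1 - (\<Sum>e'\<in>E - {e\<^sub>0}. y e')) \<in> borel_measurable (PiM (E - {e\<^sub>0}) M)"
      by (intro borel_measurable_diff borel_measurable_sum comp) auto
    with True show ?thesis
      by (simp add: hyperplane_point_def)
  next
    case False
    then show ?thesis
      by (cases "e \<in> E") (auto simp: hyperplane_point_def intro: comp)
  qed
  then show "(\<lambda>x. hyperplane_point E e\<^sub>0 x \<bullet> i) \<in> borel_measurable (PiM (E - {e\<^sub>0}) M)"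
    by (simp add: i flip: cart_eq_inner_axis)
qed

text \<open>The hyperplane measure in an explicit chart, with the eliminated coordinate as a
  parameter, so that charts can be compared.\<close>

definition hyperplane_lborel :: "'c::finite set \<Rightarrow> 'c \<Rightarrow> (real ^ 'c) measure" where
  "hyperplane_lborel E e\<^sub>0 = distr (PiM (E - {e\<^sub>0}) (\<lambda>_. lborel)) borel (hyperplane_point E e\<^sub>0)"

lemma hyperplane_measure_eq: "hyperplane_measure E {} = hyperplane_lborel E (SOME e. e \<in> E)"
  by (simp add: hyperplane_measure_def hyperplane_lborel_def Let_def)

lemma sets_hyperplane_measure[measurable_cong]: "sets (hyperplane_measure E F) = sets borel"
  by (simp add: hyperplane_measure_def Let_def)

interpretation lborel_product: product_sigma_finite "\<lambda>_. lborel :: real measure"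
  by unfold_locales

lemma nn_integral_hyperplane_lborel:
  assumes "f \<in> borel_measurable borel"
  shows "integral\<^sup>N (hyperplane_lborel E e\<^sub>0) f =
    (\<integral>\<^sup>+ y. f (hyperplane_point E e\<^sub>0 y) \<partial>PiM (E - {e\<^sub>0}) (\<lambda>_. lborel))"
  unfolding hyperplane_lborel_def
  by (intro nn_integral_distr measurable_hyperplane_point) (auto intro: assms)

text \<open>Only the coordinate \<open>e\<^sub>0\<close> is replaced by \<open>e\<^sub>1\<close>; the other ones being fixed, this is a reflection of the line.\<close>

lemma nn_integral_hyperplane_lborel_indep:
  fixes E :: "'c::finite set"
  assumes f: "f \<in> borel_measurable borel" and e: "e\<^sub>0 \<in> E" "e\<^sub>1 \<in> E"
  shows "integral\<^sup>N (hyperplane_lborel E e\<^sub>0) f = integral\<^sup>N (hyperplane_lborel E e\<^sub>1) f"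
proof (cases "e\<^sub>0 = e\<^sub>1")
  case False
  define I where "I = E - {e\<^sub>0, e\<^sub>1}"
  have I: "E - {e\<^sub>0} = insert e\<^sub>1 I" "E - {e\<^sub>1} = insert e\<^sub>0 I" "e\<^sub>0 \<notin> I" "e\<^sub>1 \<notin> I"
    using False e by (auto simp: I_def)
  have meas: "(\<lambda>y. f (hyperplane_point E a y)) \<in> borel_measurable (PiM (E - {a}) (\<lambda>_. lborel))" for a
    using measurable_hyperplane_point f by (rule measurable_compose) simp
  \<comment> \<open>The substitution is written as an affine map of slope \<open>- 1\<close>, whose
    Jacobian factor is \<open>1\<close>.\<close>
  have pt: "hyperplane_point E e\<^sub>0 (z(e\<^sub>1 := (1 - sum z I) + - 1 * t)) = hyperplane_point E e\<^sub>1 (z(e\<^sub>0 := t))" for z t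
  proof -
    have "(\<Sum>e\<in>I. (z(a := s)) e) = sum z I" if "a \<notin> I" for s a
      by (rule sum.cong[OF refl]) (use that in auto)
    from this[OF I(3)] this[OF I(4)] have "hyperplane_point E e\<^sub>0 (z(e\<^sub>1 := (1 - sum z I) + - 1 * t)) $ e = hyperplane_point E e\<^sub>1 (z(e\<^sub>0 := t)) $ e" for e
      unfolding hyperplane_point_def I(1,2)
      using I(3,4) False e by (cases "e = e\<^sub>0"; cases "e = e\<^sub>1"; simp)
    then show ?thesis
      unfolding vec_eq_iff by (rule allI)
  qed
  have "integral\<^sup>N (hyperplane_lborel E e\<^sub>0) f =
      (\<integral>\<^sup>+ z. (\<integral>\<^sup>+ t. f (hyperplane_point E e\<^sub>0 (z(e\<^sub>1 := t))) \<partial>lborel) \<partial>PiM I (\<lambda>_. lborel))"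
    unfolding nn_integral_hyperplane_lborel[OF f] I(1)
    using meas[of e\<^sub>0, unfolded I(1)] I(4) by (rule lborel_product.product_nn_integral_insert[OF finite, rotated])
  also have "\<dots> = (\<integral>\<^sup>+ z. (\<integral>\<^sup>+ t. f (hyperplane_point E e\<^sub>1 (z(e\<^sub>0 := t))) \<partial>lborel) \<partial>PiM I (\<lambda>_. lborel))"
  proof (rule nn_integral_cong)
    fix z :: "'c \<Rightarrow> real" assume z: "z \<in> space (PiM I (\<lambda>_. lborel))"
    have "(\<lambda>t. f (hyperplane_point E e\<^sub>0 (z(e\<^sub>1 := t)))) \<in> borel_measurable borel"
      using measurable_comp[OF measurable_component_update[OF z I(4)] meas[of e\<^sub>0, unfolded I(1)]]
      by (simp add: comp_def)
    then show "(\<integral>\<^sup>+ t. f (hyperplane_point E e\<^sub>0 (z(e\<^sub>1 := t))) \<partial>lborel) =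
        (\<integral>\<^sup>+ t. f (hyperplane_point E e\<^sub>1 (z(e\<^sub>0 := t))) \<partial>lborel)"
      by (subst nn_integral_real_affine[where c = "- 1" and t = "1 - sum z I"]) (simp_all only: pt, simp_all)
  qed
  also have "\<dots> = integral\<^sup>N (hyperplane_lborel E e\<^sub>1) f"
    unfolding nn_integral_hyperplane_lborel[OF f] I(2)
    using meas[of e\<^sub>1, unfolded I(2)] I(3) by (rule lborel_product.product_nn_integral_insert[OF finite, rotated, symmetric])
  finally show ?thesis .
qed simp

text \<open>In the chart eliminating \<open>e\<^sub>1\<close> the remaining coordinates are
  independent, so the integral factors. Independence of the chart allows this one to be
  used.\<close>

lemma nn_integral_hyperplane_measure_prod:
  fixes E :: "'c::finite set"
  assumes e: "e\<^sub>1 \<in> E" and g[measurable]: "\<And>e. g e \<in> borel_measurable borel"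
  shows "(\<integral>\<^sup>+ x. (\<Prod>e\<in>E - {e\<^sub>1}. g e (x $ e)) \<partial>hyperplane_measure E {}) = (\<Prod>e\<in>E - {e\<^sub>1}. \<integral>\<^sup>+ y. g e y \<partial>lborel)"
proof -
  have meas: "(\<lambda>x :: real ^ 'c. \<Prod>e\<in>E - {e\<^sub>1}. g e (x $ e)) \<in> borel_measurable borel"
  proof (intro borel_measurable_prod_ennreal)
    fix e
    have "(\<lambda>x :: real ^ 'c. x $ e) \<in> borel_measurable borel"
      by (intro borel_measurable_continuous_onI continuous_intros)
    then show "(\<lambda>x :: real ^ 'c. g e (x $ e)) \<in> borel_measurable borel"
      by measurable
  qed
  have "(SOME e. e \<in> E) \<in> E"
    using e by (rule someI)
  then have "(\<integral>\<^sup>+ x. (\<Prod>e\<in>E - {e\<^sub>1}. g e (x $ e)) \<partial>hyperplane_measure E {}) =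
      (\<integral>\<^sup>+ x. (\<Prod>e\<in>E - {e\<^sub>1}. g e (x $ e)) \<partial>hyperplane_lborel E e\<^sub>1)"
    unfolding hyperplane_measure_eq by (intro nn_integral_hyperplane_lborel_indep meas e)
  also have "\<dots> = (\<integral>\<^sup>+ y. (\<Prod>e\<in>E - {e\<^sub>1}. g e (y e)) \<partial>PiM (E - {e\<^sub>1}) (\<lambda>_. lborel))"
    unfolding nn_integral_hyperplane_lborel[OF meas] by (simp add: hyperplane_point_nth)
  also have "\<dots> = (\<Prod>e\<in>E - {e\<^sub>1}. \<integral>\<^sup>+ y. g e y \<partial>lborel)"
    by (intro lborel_product.product_nn_integral_prod) auto
  finally show ?thesis .
qed

text \<open>The value at \<open>0\<close> is infinite, so that no null sets have to be excluded in pointwise estimates.\<close>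

definition singular_power :: "real \<Rightarrow> real \<Rightarrow> ennreal" where
  "singular_power b y = (if y = 0 then top else ennreal (y powr - b)) * indicator {0..1} y"

lemma measurable_singular_power[measurable]: "singular_power b \<in> borel_measurable borel"
  unfolding singular_power_def[abs_def] by measurable

lemma singular_power_ge_1:
  assumes "0 \<le> b" "0 \<le> y" "y \<le> 1"
  shows "1 \<le> singular_power b y"
proof (cases "y = 0")
  case False
  then have "1 \<le> y powr - b"
    using assms by (metis less_eq_real_def powr_mono' powr_zero_eq_one neg_le_0_iff_le)
  then show ?thesis
    using False assms by (simp add: singular_power_def)
qed (simp add: singular_power_def)

text \<open>The infinite value is attained only on the null set \<open>{0}\<close>; elsewhere this
  is the integral of a power greater than \<open>- 1\<close>.\<close>

lemma nn_integral_singular_power: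
  assumes "b < 1"
  shows "(\<integral>\<^sup>+ y. singular_power b y \<partial>lborel) < top"
proof -
  have "((\<lambda>y. y powr - b) has_integral (1 powr (- b + 1) / (- b + 1))) {0..1}"
    by (rule has_integral_powr_from_0) (use assms in auto)
  then have "((\<lambda>y. y powr - b * indicator {0..1} y) has_integral (1 powr (- b + 1) / (- b + 1))) UNIV"
    by (subst (asm) has_integral_restrict_UNIV[symmetric]) (simp add: indicator_def of_bool_def if_distrib cong: if_cong)
  then have "(\<integral>\<^sup>+ y. ennreal (y powr - b * indicator {0..1} y) \<partial>lborel) = ennreal (1 powr (- b + 1) / (- b + 1))"
    by (intro nn_integral_has_integral_lborel) auto
  moreover have "(\<integral>\<^sup>+ y. singular_power b y \<partial>lborel) = (\<integral>\<^sup>+ y. ennreal (y powr - b * indicator {0..1} y) \<partial>lborel)"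
    using AE_lborel_singleton[of 0]
    by (intro nn_integral_cong_AE, eventually_elim) (auto simp: singular_power_def indicator_def)
  ultimately show ?thesis
    by simp
qed

text \<open>The integrable majorant, singular where edges of \<open>S\<close> shrink. The coordinate
  \<open>e\<^sub>1\<close> is left free for elimination, and the others are cut off to the unit
  interval to keep the total integral finite.\<close>

definition singular_weight :: "'c::finite set \<Rightarrow> 'c set \<Rightarrow> 'c \<Rightarrow> real \<Rightarrow> (real ^ 'c) \<Rightarrow> ennreal" where
  "singular_weight E S e\<^sub>1 b x = (\<Prod>e\<in>E - {e\<^sub>1}. (if e \<in> S then singular_power b else indicator {0..1}) (x $ e))"

lemma measurable_singular_weight[measurable]:
  fixes E :: "'c::finite set"
  shows "singular_weight E S e\<^sub>1 b \<in> borel_measurable borel"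
  unfolding singular_weight_def[abs_def]
proof (intro borel_measurable_prod_ennreal)
  fix e :: 'c
  have "(\<lambda>x :: real ^ 'c. x $ e) \<in> borel_measurable borel"
    by (intro borel_measurable_continuous_onI continuous_intros)
  then show "(\<lambda>x :: real ^ 'c. (if e \<in> S then singular_power b else indicator {0..1}) (x $ e)) \<in> borel_measurable borel"
    by (cases "e \<in> S"; simp)
qed

lemma nn_integral_singular_weight:
  assumes "e\<^sub>1 \<in> E" "b < 1"
  shows "(\<integral>\<^sup>+ x. singular_weight E S e\<^sub>1 b x \<partial>hyperplane_measure E {}) < top"
proof -
  have *: "(\<integral>\<^sup>+ y. (if e \<in> S then singular_power b else indicator {0..1}) y \<partial>lborel) < top" for e
    using nn_integral_singular_power[OF assms(2)] by (cases "e \<in> S") simp_all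
  show ?thesis
    unfolding singular_weight_def using *
    by (subst nn_integral_hyperplane_measure_prod[OF assms(1)])
      (auto simp: ennreal_prod_eq_top less_top[symmetric])
qed

lemma prod_mono_ennreal:
  fixes f g :: "'a \<Rightarrow> ennreal"
  shows "(\<And>i. i \<in> A \<Longrightarrow> f i \<le> g i) \<Longrightarrow> prod f A \<le> prod g A"
  by (induction A rule: infinite_finite_induct) (auto intro!: mult_mono)

lemma prod_ge_1_ennreal:
  fixes f :: "'a \<Rightarrow> ennreal"
  shows "(\<And>i. i \<in> A \<Longrightarrow> 1 \<le> f i) \<Longrightarrow> 1 \<le> prod f A"
  using prod_mono_ennreal[of A "\<lambda>_. 1" f] by simp

text \<open>On the simplex all cut-offs equal \<open>1\<close> and all singular factors are at least
  \<open>1\<close>. The first bound absorbs the bounded part of the density, the second its singular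
  part.\<close>

lemma singular_weight_ge:
  fixes E :: "'c::finite set"
  assumes "0 \<le> b" "S \<subseteq> E - {e\<^sub>1}" "\<And>e. e \<in> E \<Longrightarrow> 0 \<le> x $ e \<and> x $ e \<le> 1"
  shows "1 \<le> singular_weight E S e\<^sub>1 b x" "(\<Prod>e\<in>S. singular_power b (x $ e)) \<le> singular_weight E S e\<^sub>1 b x"
proof -
  have E: "E - {e\<^sub>1} - S \<union> S = E - {e\<^sub>1}" "(E - {e\<^sub>1} - S) \<inter> S = {}"
    using assms(2) by auto
  let ?rest = "\<Prod>e\<in>E - {e\<^sub>1} - S. indicator {0..1} (x $ e) :: ennreal"
  have "singular_weight E S e\<^sub>1 b x = ?rest * (\<Prod>e\<in>S. singular_power b (x $ e))"
    unfolding singular_weight_def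
    by (subst E(1)[symmetric], subst prod.union_disjoint) (use E(2) in auto)
  also have "?rest = 1"
    using assms(3) by (intro prod.neutral) (auto simp: indicator_def)
  finally show "(\<Prod>e\<in>S. singular_power b (x $ e)) \<le> singular_weight E S e\<^sub>1 b x"
    by simp
  show "1 \<le> singular_weight E S e\<^sub>1 b x"
    unfolding singular_weight_def
    by (rule prod_ge_1_ennreal) (use assms singular_power_ge_1 in auto)
qed

section \<open>Lower bounds for the second Symanzik polynomial\<close>

definition tree_weight :: "'c::finite cgraph \<Rightarrow> 'c set \<Rightarrow> (real ^ 'c) \<Rightarrow> real" where
  "tree_weight G T x = (\<Prod>e\<in>edges G - T. x $ e)"

definition tree_coeff ::
  "((real ^ 'd::finite) \<Rightarrow> real) \<Rightarrow> nat \<Rightarrow> (nat \<Rightarrow> (real ^ 'd)) \<Rightarrow> ('c \<Rightarrow> real) \<Rightarrow>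
     'c cgraph \<Rightarrow> 'c set \<Rightarrow> 'c \<Rightarrow> real" where
  "tree_coeff q k p m G T e = (m e)\<^sup>2 + (if e \<in> T then momentum_square q k p G (T - {e}) else 0)"

lemma tree_coeff_nonneg:
  "spacetime_form q \<Longrightarrow> generic_momenta q k p \<Longrightarrow> 0 \<le> tree_coeff q k p m G T e"
  by (simp add: tree_coeff_def momentum_square_nonneg)

lemma psi_eq_sum_tree_weight: "psi G x = (\<Sum>T\<in>spanning_trees G. tree_weight G T x)"
  by (simp add: psi_def tree_weight_def)

lemma tree_weight_nonneg:
  "(\<And>e. e \<in> edges G \<Longrightarrow> 0 \<le> x $ e) \<Longrightarrow> 0 \<le> tree_weight G T x"
  unfolding tree_weight_def by (intro prod_nonneg) auto

lemma phi_nonneg: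
  assumes "spacetime_form q" "generic_momenta q k p" "\<And>e. e \<in> edges G \<Longrightarrow> 0 \<le> x $ e"
  shows "0 \<le> phi q k p G x"
  unfolding phi_alt using assms
  by (intro sum_nonneg mult_nonneg_nonneg prod_nonneg) (auto simp: momentum_square_nonneg)

lemma Xi_nonneg:
  assumes "spacetime_form q" "generic_momenta q k p" "\<And>e. e \<in> edges G \<Longrightarrow> 0 \<le> x $ e"
  shows "0 \<le> Xi q k p m G x"
  unfolding Xi_def psi_eq_sum_tree_weight using assms
  by (intro add_nonneg_nonneg mult_nonneg_nonneg sum_nonneg phi_nonneg tree_weight_nonneg) auto

text \<open>Only the 2-forests \<open>T - {e}\<close> are kept. They are distinct for distinct
  \<open>e\<close>, their monomials are \<open>x $ e\<close> times the weight of \<open>T\<close>,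
  and all discarded terms are nonnegative.\<close>

lemma phi_ge:
  fixes G :: "'c::finite cgraph"
  assumes wf: "wf_cgraph k G" and q: "spacetime_form q" and p: "generic_momenta q k p"
    and T: "T \<in> spanning_trees G" and x: "\<And>e. e \<in> edges G \<Longrightarrow> 0 \<le> x $ e"
  shows "tree_weight G T x * (\<Sum>e\<in>T. momentum_square q k p G (T - {e}) * x $ e) \<le> phi q k p G x"
proof -
  let ?t = "\<lambda>T. momentum_square q k p G T * (\<Prod>e\<in>edges G - T. x $ e)"
  have TE: "T \<subseteq> edges G"
    using T by (simp add: spanning_trees_def forest_def)
  have prod: "(\<Prod>e'\<in>edges G - (T - {e}). x $ e') = x $ e * tree_weight G T x" if "e \<in> T" for e
  proof -
    have "edges G - (T - {e}) = insert e (edges G - T)"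
      using that TE by auto
    then show ?thesis
      using that by (simp add: tree_weight_def)
  qed
  have "tree_weight G T x * (\<Sum>e\<in>T. momentum_square q k p G (T - {e}) * x $ e) = (\<Sum>e\<in>T. ?t (T - {e}))"
    unfolding sum_distrib_left by (intro sum.cong refl) (simp add: prod)
  also have "\<dots> = sum ?t ((\<lambda>e. T - {e}) ` T)"
    by (subst sum.reindex) (auto simp: inj_on_def)
  also have "\<dots> \<le> sum ?t (spanning_2_forests G)"
    using spanning_tree_remove_edge[OF wf T] x
    by (intro sum_mono2 mult_nonneg_nonneg prod_nonneg) (auto simp: momentum_square_nonneg[OF q p])
  finally show ?thesis
    by (simp add: phi_alt)
qed

text \<open>The momentum part is \<open>phi_ge\<close>; for the mass part only the term of
  \<open>T\<close> is kept in \<open>psi\<close>.\<close>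

lemma Xi_ge:
  fixes G :: "'c::finite cgraph"
  assumes wf: "wf_cgraph k G" and q: "spacetime_form q" and p: "generic_momenta q k p"
    and T: "T \<in> spanning_trees G" and x: "\<And>e. e \<in> edges G \<Longrightarrow> 0 \<le> x $ e"
  shows "tree_weight G T x * (\<Sum>e\<in>edges G. tree_coeff q k p m G T e * x $ e) \<le> Xi q k p m G x"
proof -
  have TE: "T \<subseteq> edges G"
    using T by (simp add: spanning_trees_def forest_def)
  have "(\<Sum>e\<in>edges G. (if e \<in> T then momentum_square q k p G (T - {e}) else 0) * x $ e) =
      (\<Sum>e\<in>T. momentum_square q k p G (T - {e}) * x $ e)"
    using TE by (intro sum.mono_neutral_cong_right) auto
  then have "tree_weight G T x * (\<Sum>e\<in>edges G. tree_coeff q k p m G T e * x $ e) =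
      tree_weight G T x * (\<Sum>e\<in>T. momentum_square q k p G (T - {e}) * x $ e) +
      tree_weight G T x * (\<Sum>e\<in>edges G. (m e)\<^sup>2 * x $ e)"
    by (simp add: tree_coeff_def distrib_right sum.distrib distrib_left)
  also have "\<dots> \<le> phi q k p G x + psi G x * (\<Sum>e\<in>edges G. (m e)\<^sup>2 * x $ e)"
  proof (intro add_mono phi_ge[OF wf q p T] x mult_right_mono sum_nonneg mult_nonneg_nonneg)
    show "tree_weight G T x \<le> psi G x"
      unfolding psi_eq_sum_tree_weight
      using T x tree_weight_nonneg by (intro member_le_sum) auto
  qed (use x in auto)
  finally show ?thesis
    by (simp add: Xi_def)
qed

lemma Xi_ge_edge:
  fixes G :: "'c::finite cgraph"
  assumes wf: "wf_cgraph k G" and q: "spacetime_form q" and p: "generic_momenta q k p"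
    and T: "T \<in> spanning_trees G" and x: "\<And>e. e \<in> edges G \<Longrightarrow> 0 \<le> x $ e"
    and e: "e \<in> edges G" and c: "0 \<le> c" "c \<le> tree_weight G T x"
  shows "c * (tree_coeff q k p m G T e * x $ e) \<le> Xi q k p m G x"
proof -
  have "tree_coeff q k p m G T e * x $ e \<le> (\<Sum>e\<in>edges G. tree_coeff q k p m G T e * x $ e)"
    using e x by (intro member_le_sum mult_nonneg_nonneg tree_coeff_nonneg[OF q p]) auto
  then have "c * (tree_coeff q k p m G T e * x $ e) \<le>
      tree_weight G T x * (\<Sum>e\<in>edges G. tree_coeff q k p m G T e * x $ e)"
    using c x e by (intro mult_mono mult_nonneg_nonneg tree_coeff_nonneg[OF q p]) auto
  also note Xi_ge[OF wf q p T x]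
  finally show ?thesis .
qed

lemma cell_bounds:
  assumes "x \<in> cell G" "e \<in> edges G"
  shows "0 \<le> x $ e" "x $ e \<le> 1"
proof -
  have nn: "\<And>e. e \<in> edges G \<Longrightarrow> 0 \<le> x $ e" and sum: "(\<Sum>e\<in>edges G. x $ e) = 1"
    using assms by (auto simp: cell_def)
  show "0 \<le> x $ e" using nn assms by simp
  have "x $ e \<le> (\<Sum>e\<in>edges G. x $ e)"
    using nn assms by (intro member_le_sum) auto
  then show "x $ e \<le> 1" by (simp add: sum)
qed

text \<open>A spanning tree containing all edges of length \<open>0\<close> has a positive
  monomial.\<close>

lemma psi_pos:
  fixes G :: "'c::finite cgraph"
  assumes wf: "wf_cgraph k G" and con: "graph_connected G (edges G)" and x: "x \<in> cell G"
  shows "0 < psi G x"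
proof -
  obtain T where T: "T \<in> spanning_trees G" "zero_edges G x \<subseteq> T"
    using spanning_tree_extension[OF wf con] x by (auto simp: cell_def)
  have "0 < tree_weight G T x"
    unfolding tree_weight_def
  proof (rule prod_pos)
    fix e assume e: "e \<in> edges G - T"
    with T have "x $ e \<noteq> 0" by (auto simp: zero_edges_def)
    with e cell_bounds[OF x, of e] show "0 < x $ e" by auto
  qed
  also have "tree_weight G T x \<le> psi G x"
    unfolding psi_eq_sum_tree_weight
    using T cell_bounds[OF x] by (intro member_le_sum tree_weight_nonneg) auto
  finally show ?thesis .
qed

text \<open>A point of the cell provides an edge, since the lengths add up to \<open>1\<close>.
  Deleting it lowers the rank, whereas every subset of a forest has rank \<open>0\<close>.\<close>

lemma edges_not_forest:
  fixes G :: "'c::finite cgraph"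
  assumes adm: "admissible n k G" and x: "x \<in> cell G"
  shows "\<not> forest G (edges G)"
proof
  assume f: "forest G (edges G)"
  have wf: "wf_cgraph k G"
    using adm by (simp add: admissible_def)
  have "edges G \<noteq> {}"
    using x by (auto simp: cell_def)
  then obtain e where e: "e \<in> edges G" by auto
  have "betti G (edges G - {e}) < betti G (edges G)"
    using adm e unfolding admissible_def by blast
  moreover have "forest G (edges G - {e})"
    using forest_subset[OF wf f] by blast
  ultimately show False
    using f by (simp add: forest_def)
qed

text \<open>
  If all edges contributing to the lower bound of \<open>Xi_ge\<close> lie in \<open>T\<close>, then \<open>Xi\<close> vanishes
  on the face where exactly these edges have length \<open>0\<close>.
\<close>

lemma critical_face:
  fixes G :: "'c::finite cgraph" and q :: "(real ^ 'd::finite) \<Rightarrow> real"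
  assumes adm: "admissible n k G" and q: "spacetime_form q" and p: "generic_momenta q k p"
    and defined: "feynman_density_defined q k p m G" and ne: "x\<^sub>0 \<in> cell G"
    and T: "T \<in> spanning_trees G"
    and S_def: "S = {e \<in> edges G. 0 < tree_coeff q k p m G T e}" and S: "S \<subseteq> T"
  shows "0 < real CARD('d) * of_int (betti G (edges G)) - 2 * real (card (edges G - S))"
proof -
  have wf: "wf_cgraph k G"
    using adm by (simp add: admissible_def)
  have T': "forest G T" "graph_connected G T"
    using T by (auto simp: spanning_trees_def)
  have fS: "forest G S"
    by (rule forest_subset[OF wf T'(1) S])
  have SE: "S \<subseteq> edges G"
    by (auto simp: S_def)
  \<comment> \<open>The face must be nonempty for its barycentre \<open>y\<close> to exist.\<close>
  have ne: "edges G - S \<noteq> {}"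
  proof
    assume "edges G - S = {}"
    with SE have "S = edges G" by blast
    with fS edges_not_forest[OF adm ne] show False by simp
  qed
  define y :: "real ^ 'c" where "y = (\<chi> e. if e \<in> edges G - S then 1 / card (edges G - S) else 0)"
  have card: "real (card (edges G - S)) > 0"
    using ne by (simp add: card_gt_0_iff)
  have y1: "y $ e > 0" if "e \<in> edges G - S" for e
    using that card by (simp add: y_def)
  have y0: "y $ e = 0" if "e \<notin> edges G - S" for e
    using that unfolding y_def vec_lambda_beta by (rule if_not_P)
  \<comment> \<open>Used twice: for the total length, and for the summand
    \<open>2 * heaviside x - 1\<close> of the superficial degree, which also vanishes at
    \<open>0\<close>.\<close>
  have sum_eq: "(\<Sum>e\<in>edges G. g (y $ e)) = card (edges G - S) * g (1 / card (edges G - S))"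
    if "g 0 = 0" for g :: "real \<Rightarrow> real"
  proof -
    have "(\<Sum>e\<in>edges G. g (y $ e)) = (\<Sum>e\<in>edges G - S. g (1 / card (edges G - S)))"
      using that SE by (intro sum.mono_neutral_cong_right) (auto simp: y_def)
    then show ?thesis by simp
  qed
  have "zero_edges G y = S"
  proof -
    have "y $ e = 0 \<longleftrightarrow> e \<in> S" if "e \<in> edges G" for e
      using that y0[of e] y1[of e] by force
    then show ?thesis
      using SE by (auto simp: zero_edges_def)
  qed
  moreover have "(\<Sum>e\<in>edges G. y $ e) = 1"
    using sum_eq[of "\<lambda>x. x"] ne by simp
  moreover have "0 \<le> y $ e" for e
    using y0[of e] y1[of e] by (cases "e \<in> edges G - S") (auto intro: less_imp_le)
  moreover have "y $ e = 0" if "e \<notin> edges G" for e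
    using y0 that by simp
  ultimately have cell: "y \<in> cell G"
    using fS by (simp add: cell_def)
  \<comment> \<open>An edge of \<open>T - S\<close> separating two legs would carry positive squared
    momentum and thus belong to \<open>S\<close>. So all of \<open>T - S\<close> can be deleted at
    once.\<close>
  have legs: "(leg G i, leg G j) \<in> conn G S" if ij: "i \<in> {1..k}" "j \<in> {1..k}" for i j
  proof -
    have "(leg G i, leg G j) \<in> conn G (T - (T - S))"
    proof (rule forest_conn_Diff[OF wf T'(1)])
      have "leg G i \<in> verts G" "leg G j \<in> verts G"
        using wf ij by (auto simp: wf_cgraph_def)
      then show "(leg G i, leg G j) \<in> conn G T"
        using T'(2) unfolding graph_connected_def by blast
    next
      fix e assume e: "e \<in> T - S"
      have two: "card (components G (T - {e})) = 2"
        using spanning_tree_remove_edge[OF wf T, of e] e by (simp add: spanning_2_forests_def)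
      have eE: "e \<in> edges G"
        using e T'(1) by (auto simp: forest_def)
      show "(leg G i, leg G j) \<in> conn G (T - {e})"
      proof (rule ccontr)
        assume n: "(leg G i, leg G j) \<notin> conn G (T - {e})"
        have "0 < momentum_square q k p G (T - {e})"
          using momentum_square_pos[OF wf q p two ij n] .
        then have "0 < (m e)\<^sup>2 + momentum_square q k p G (T - {e})"
          by (rule add_nonneg_pos[OF zero_le_power2])
        moreover have "tree_coeff q k p m G T e = (m e)\<^sup>2 + momentum_square q k p G (T - {e})"
          using e by (simp add: tree_coeff_def)
        ultimately have "e \<in> S"
          using eE by (simp add: S_def)
        with e show False by simp
      qed
    qed
    moreover have "T - (T - S) = S"
      using S by blast
    ultimately show ?thesis
      by simp
  qed
  \<comment> \<open>A 2-forest containing \<open>S\<close> keeps all legs together and has momentum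
    \<open>0\<close>; any other one has a factor \<open>y $ e = 0\<close> in its monomial.\<close>
  have "phi q k p G y = 0"
    unfolding phi_alt
  proof (rule sum.neutral, rule ballI)
    fix T' assume T': "T' \<in> spanning_2_forests G"
    show "momentum_square q k p G T' * (\<Prod>e\<in>edges G - T'. y $ e) = 0"
    proof (cases "S \<subseteq> T'")
      case True
      have "momentum_square q k p G T' = 0"
      proof (rule momentum_square_eq_0[OF q p])
        show "card (components G T') = 2"
          using T' by (simp add: spanning_2_forests_def)
        show "(leg G i, leg G j) \<in> conn G T'" if "i \<in> {1..k}" "j \<in> {1..k}" for i j
          using conn_mono[OF True] legs[OF that] by (rule subsetD)
      qed
      then show ?thesis by simp
    next
      case False
      then obtain e where "e \<in> S" "e \<notin> T'" by blast
      with y0 SE have "(\<Prod>e\<in>edges G - T'. y $ e) = 0"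
        by (intro prod_zero) auto
      then show ?thesis by simp
    qed
  qed
  \<comment> \<open>Outside \<open>S\<close> both nonnegative summands of \<open>tree_coeff\<close>
    vanish, in particular the mass; on \<open>S\<close> the length is \<open>0\<close>.\<close>
  moreover have "(\<Sum>e\<in>edges G. (m e)\<^sup>2 * y $ e) = 0"
  proof (rule sum.neutral, rule ballI)
    fix e assume e: "e \<in> edges G"
    show "(m e)\<^sup>2 * y $ e = 0"
    proof (cases "e \<in> S")
      case False
      have "0 \<le> (if e \<in> T then momentum_square q k p G (T - {e}) else 0)"
        by (simp add: momentum_square_nonneg[OF q p])
      moreover have "tree_coeff q k p m G T e \<le> 0"
        using False e by (simp add: S_def)
      ultimately have "(m e)\<^sup>2 \<le> 0"
        unfolding tree_coeff_def by linarith
      then show ?thesis by simp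
    qed (simp add: y0)
  qed
  ultimately have "Xi q k p m G y = 0"
    by (simp add: Xi_def)
  with defined cell have "superficial_degree CARD('d) G y > 0"
    by (simp add: feynman_density_defined_def)
  moreover have "(\<Sum>e\<in>edges G. 2 * heaviside (y $ e) - 1) = card (edges G - S)"
    using sum_eq[of "\<lambda>x. 2 * heaviside x - 1"] card by (simp add: heaviside_def)
  ultimately show ?thesis
    by (simp add: superficial_degree_def)
qed

section \<open>Local integrability\<close>

text \<open>To be applied with \<open>P = psi\<close>, \<open>X = Xi\<close> and \<open>s\<close>
  half the superficial degree. Since \<open>s\<close> jumps between faces, the bound must be uniform
  in \<open>s\<close>. For \<open>s \<ge> 0\<close> the ratio \<open>X / P\<close> is bounded; for
  \<open>s < 0\<close> the worst case is \<open>X powr - a\<close>. At \<open>X = 0\<close> the left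
  side is \<open>0\<close> by convention.\<close>

lemma powr_density_bound:
  fixes P X c M a s t r :: real
  assumes P: "0 < c" "c \<le> P" "P \<le> M" and X: "0 \<le> X" "X \<le> M" and s: "- a \<le> s" "s \<le> t" and a: "0 \<le> a"
    and r: "0 \<le> r"
  shows "P powr - r * (P / X) powr - s \<le>
    c powr - r * (max 1 (M / c) powr \<bar>t\<bar> + 1 + M powr a) * (1 + X powr - a)"
proof -
  \<comment> \<open>The maximum with \<open>1\<close> makes powers of \<open>?L\<close> monotone in
    the exponent.\<close>
  let ?L = "max 1 (M / c)"
  have "(P / X) powr - s \<le> (?L powr \<bar>t\<bar> + 1 + M powr a) * (1 + X powr - a)" (is "_ \<le> ?B * _")
  proof (cases "X = 0")
    case False
    with X P have X0: "0 < X" "0 < P" "0 < M" by auto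
    have "(P / X) powr - s \<le> ?L powr \<bar>t\<bar> + (1 + M powr a * X powr - a)"
    proof (cases "0 \<le> s")
      case True
      have "(P / X) powr - s = (X / P) powr s"
        using X0 by (simp add: powr_divide powr_minus divide_simps)
      also have "\<dots> \<le> ?L powr s"
      proof (rule powr_mono2[OF True])
        have "X / P \<le> M / c"
          using P X X0 by (intro frac_le) auto
        then show "X / P \<le> ?L" by simp
      qed (use X0 in simp)
      also have "\<dots> \<le> ?L powr \<bar>t\<bar>"
        using True s by (intro powr_mono) auto
      finally show ?thesis
        by (smt (verit) powr_ge_zero mult_nonneg_nonneg)
    next
      case False
      have "(P / X) powr - s \<le> 1 + M powr a * X powr - a"
      proof (cases "P / X \<le> 1")
        case True
        then have "(P / X) powr - s \<le> 1"
          using False X0 by (intro powr_le1) auto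
        then show ?thesis
          by (smt (verit) powr_ge_zero mult_nonneg_nonneg)
      next
        case False
        then have "(P / X) powr - s \<le> (P / X) powr a"
          using s by (intro powr_mono) auto
        also have "\<dots> \<le> (M / X) powr a"
          using a P X0 by (intro powr_mono2) (auto intro: divide_right_mono)
        also have "\<dots> = M powr a * X powr - a"
          using X0 by (simp add: powr_divide powr_minus divide_simps)
        finally show ?thesis by simp
      qed
      then show ?thesis
        by (smt (verit) powr_ge_zero)
    qed
    also have "\<dots> \<le> ?B * (1 + X powr - a)"
      by (simp add: algebra_simps)
    finally show ?thesis .
  qed simp
  moreover have "P powr - r \<le> c powr - r"
    using P r by (intro powr_mono2') auto
  ultimately have "P powr - r * (P / X) powr - s \<le> c powr - r * (?B * (1 + X powr - a))"
    by (intro mult_mono) auto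
  then show ?thesis
    by (simp only: mult.assoc)
qed

lemma superficial_degree_bounds:
  assumes "x \<in> cell G"
  shows "real d * of_int (betti G (edges G)) - 2 * real (card (edges G)) \<le> superficial_degree d G x"
    and "superficial_degree d G x \<le> real d * of_int (betti G (edges G))"
proof -
  have "0 \<le> 2 * heaviside (x $ e) - 1 \<and> 2 * heaviside (x $ e) - 1 \<le> 1" if "e \<in> edges G" for e
    using cell_bounds[OF assms that] by (simp add: heaviside_def)
  then have "0 \<le> (\<Sum>e\<in>edges G. 2 * heaviside (x $ e) - 1)"
    "(\<Sum>e\<in>edges G. 2 * heaviside (x $ e) - 1) \<le> (\<Sum>e\<in>edges G. 1)"
    by (auto intro!: sum_nonneg sum_mono simp del: sum_constant)
  then show "real d * of_int (betti G (edges G)) - 2 * real (card (edges G)) \<le> superficial_degree d G x"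
    "superficial_degree d G x \<le> real d * of_int (betti G (edges G))"
    by (simp_all add: superficial_degree_def)
qed

lemma continuous_on_psi: "continuous_on A (psi G)"
  unfolding psi_def[abs_def] by (intro continuous_intros)

lemma continuous_on_Xi: "continuous_on A (Xi q k p m G)"
  unfolding Xi_def[abs_def] phi_alt by (intro continuous_intros continuous_on_psi)

text \<open>All other factors are at most \<open>1\<close>. A lower bound for the weight therefore
  keeps every edge outside \<open>T\<close> away from length \<open>0\<close>.\<close>

lemma tree_weight_le_edge:
  assumes "x \<in> cell G" "e \<in> edges G - T"
  shows "tree_weight G T x \<le> x $ e"
proof -
  have "tree_weight G T x = x $ e * (\<Prod>e\<in>edges G - T - {e}. x $ e)"
    unfolding tree_weight_def using assms by (intro prod.remove) auto
  also have "\<dots> \<le> x $ e * 1"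
    using assms cell_bounds[OF assms(1)] by (intro mult_left_mono prod_le_1) auto
  finally show ?thesis by simp
qed

text \<open>Provides the majorant on the region where the monomial of \<open>T\<close> is bounded
  below. Here \<open>a\<close> is the positive part of minus half the superficial degree in the
  interior of the cell, the largest exponent that can make the density singular.\<close>

lemma Xi_powr_bound:
  fixes G :: "'c::finite cgraph" and q :: "(real ^ 'd::finite) \<Rightarrow> real"
  assumes adm: "admissible n k G" and q: "spacetime_form q" and p: "generic_momenta q k p"
    and defined: "feynman_density_defined q k p m G" and ne: "x\<^sub>0 \<in> cell G"
    and T: "T \<in> spanning_trees G" and c: "0 < c"
    and a: "a = max 0 (real (card (edges G)) - real CARD('d) * of_int (betti G (edges G)) / 2)"
  shows "\<exists>S e\<^sub>1 b D. e\<^sub>1 \<in> edges G \<and> 0 \<le> b \<and> b < 1 \<and> S \<subseteq> edges G - {e\<^sub>1} \<and>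
    (\<forall>x\<in>cell G. c \<le> tree_weight G T x \<longrightarrow>
       ennreal (Xi q k p m G x powr - a) \<le> ennreal D * singular_weight (edges G) S e\<^sub>1 b x)"
proof -
  have wf: "wf_cgraph k G"
    using adm by (simp add: admissible_def)
  have "edges G \<noteq> {}"
    using ne by (auto simp: cell_def)
  then obtain e\<^sub>1 where e1: "e\<^sub>1 \<in> edges G" by auto
  \<comment> \<open>Constant bounds fit the common form with \<open>S = {}\<close> and
    \<open>b = 0\<close>, where the weight is at least \<open>1\<close>.\<close>
  have const: ?thesis
    if "\<And>x. x \<in> cell G \<Longrightarrow> c \<le> tree_weight G T x \<Longrightarrow> Xi q k p m G x powr - a \<le> D" for D
  proof -
    have "ennreal (Xi q k p m G x powr - a) \<le> ennreal D * singular_weight (edges G) {} e\<^sub>1 0 x"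
      if x: "x \<in> cell G" "c \<le> tree_weight G T x" for x
    proof -
      have "ennreal (Xi q k p m G x powr - a) \<le> ennreal D * 1"
        using that \<open>\<And>x. _ \<Longrightarrow> _ \<Longrightarrow> Xi q k p m G x powr - a \<le> D\<close>[OF x] by (simp add: ennreal_leI)
      also have "\<dots> \<le> ennreal D * singular_weight (edges G) {} e\<^sub>1 0 x"
        using cell_bounds[OF x(1)] by (intro mult_left_mono singular_weight_ge(1)) auto
      finally show ?thesis .
    qed
    with e1 show ?thesis
      by (intro exI[of _ "{}"] exI[of _ e\<^sub>1] exI[of _ 0] exI[of _ D]) auto
  qed
  define S where "S = {e \<in> edges G. 0 < tree_coeff q k p m G T e}"
  have lower: "c * (tree_coeff q k p m G T e * x $ e) \<le> Xi q k p m G x"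
    if "x \<in> cell G" "c \<le> tree_weight G T x" "e \<in> edges G" for x e
    using c that cell_bounds[OF that(1)] by (intro Xi_ge_edge[OF wf q p T]) auto
  \<comment> \<open>Either there is no singular exponent, or an edge outside \<open>T\<close> keeps
    \<open>Xi\<close> positive, or the singularity is genuine and controlled by the critical
    face.\<close>
  consider "a = 0" | e where "a > 0" "e \<in> S - T" | "a > 0" "S \<subseteq> T"
    using a by fastforce
  then show ?thesis
  proof cases
    case 1
    then show ?thesis
      by (intro const[of 1]) simp
  next
    case 2
    then have e: "e \<in> edges G - T" "0 < tree_coeff q k p m G T e"
      by (auto simp: S_def)
    show ?thesis
    proof (rule const)
      fix x assume x: "x \<in> cell G" "c \<le> tree_weight G T x"
      have "c \<le> x $ e"
        using x(2) tree_weight_le_edge[OF x(1) e(1)] by simp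
      then have "c * (tree_coeff q k p m G T e * c) \<le> c * (tree_coeff q k p m G T e * x $ e)"
        using c e by simp
      also have "\<dots> \<le> Xi q k p m G x"
        using lower x e by auto
      finally show "Xi q k p m G x powr - a \<le> (c * (tree_coeff q k p m G T e * c)) powr - a"
        using c e 2 by (intro powr_mono2') auto
    qed
  next
    case 3
    have SE: "S \<subseteq> edges G"
      by (auto simp: S_def)
    have "0 < real CARD('d) * of_int (betti G (edges G)) - 2 * real (card (edges G - S))"
      by (rule critical_face[OF adm q p defined ne T S_def 3(2)])
    moreover have "real (card (edges G - S)) = real (card (edges G)) - real (card S)"
      using SE by (simp add: card_Diff_subset card_mono of_nat_diff)
    ultimately have aS: "a < card S"
      using a 3(1) by (auto simp: max_def split: if_splits)
    with 3 have cS: "0 < real (card S)" by simp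
    \<comment> \<open>The eliminated coordinate must not be singular. It exists because
      \<open>S\<close> is a forest and \<open>edges G\<close> is not.\<close>
    obtain e\<^sub>1 where e1: "e\<^sub>1 \<in> edges G - S"
    proof -
      have "S \<noteq> edges G"
        using edges_not_forest[OF adm ne] forest_subset[OF wf _ 3(2)] T by (auto simp: spanning_trees_def)
      with SE that show thesis by blast
    qed
    \<comment> \<open>The singular exponent is shared equally among the edges of \<open>S\<close>,
      each share being less than \<open>1\<close>.\<close>
    define b where "b = a / card S"
    have b: "0 < b" "b < 1"
      using aS cS 3 by (auto simp: b_def)
    define D where "D e = (c * tree_coeff q k p m G T e) powr - b" for e
    have D: "0 < D e" if "e \<in> S" for e
      using that c by (simp add: D_def S_def)
    have "ennreal (Xi q k p m G x powr - a) \<le> ennreal (prod D S) * singular_weight (edges G) S e\<^sub>1 b x"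
      if x: "x \<in> cell G" "c \<le> tree_weight G T x" for x
    proof -
      define X where "X = Xi q k p m G x"
      have X0: "0 \<le> X"
        unfolding X_def using cell_bounds[OF x(1)] by (intro Xi_nonneg[OF q p])
      \<comment> \<open>Each edge of \<open>S\<close> on its own bounds \<open>X\<close> below by a
        multiple of its length. Multiplying these estimates over \<open>S\<close> restores the
        exponent \<open>a\<close>.\<close>
      have factor: "ennreal (X powr - b) \<le> ennreal (D e) * singular_power b (x $ e)" if e: "e \<in> S" for e
      proof (cases "x $ e = 0")
        case True
        then show ?thesis
          using D[OF e] by (simp add: singular_power_def ennreal_mult_top)
      next
        case False
        have eE: "e \<in> edges G" and ce: "0 < tree_coeff q k p m G T e"
          using e by (auto simp: S_def)
        have xe: "0 < x $ e" "x $ e \<le> 1"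
          using False cell_bounds[OF x(1) eE] by auto
        have "X powr - b \<le> (c * tree_coeff q k p m G T e * x $ e) powr - b"
          using lower[OF x eE] c ce xe b by (intro powr_mono2') (auto simp: X_def mult.assoc)
        also have "\<dots> = D e * (x $ e) powr - b"
          using c ce xe by (simp add: D_def powr_mult)
        finally have "ennreal (X powr - b) \<le> ennreal (D e * (x $ e) powr - b)"
          by (rule ennreal_leI)
        also have "\<dots> = ennreal (D e) * ennreal ((x $ e) powr - b)"
          using D[OF e] by (intro ennreal_mult) auto
        finally show ?thesis
          using xe by (simp add: singular_power_def)
      qed
      \<comment> \<open>For \<open>X = 0\<close> both sides are \<open>0\<close>, because
        \<open>S\<close> is nonempty.\<close>
      have "X powr - a = (X powr - b) ^ card S"
      proof (cases "X = 0")
        case False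
        with X0 have "(X powr - b) ^ card S = X powr (card S * - b)"
          by (simp add: powr_realpow[symmetric] powr_powr mult.commute)
        moreover have "card S * b = a"
          unfolding b_def using cS by (metis less_irrefl nonzero_mult_div_cancel_left times_divide_eq_right)
        ultimately show ?thesis
          by (simp only: mult_minus_right)
      qed (use cS in simp)
      then have "ennreal (X powr - a) = (\<Prod>e\<in>S. ennreal (X powr - b))"
        by (simp add: ennreal_power)
      also have "\<dots> \<le> (\<Prod>e\<in>S. ennreal (D e) * singular_power b (x $ e))"
        by (intro prod_mono_ennreal factor)
      also have "\<dots> = ennreal (prod D S) * (\<Prod>e\<in>S. singular_power b (x $ e))"
        using D by (simp add: prod.distrib prod_ennreal less_imp_le)
      also have "\<dots> \<le> ennreal (prod D S) * singular_weight (edges G) S e\<^sub>1 b x"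
        using b cell_bounds[OF x(1)] SE e1
        by (intro mult_left_mono singular_weight_ge(2)) auto
      finally show ?thesis
        by (simp add: X_def)
    qed
    then show ?thesis
      using e1 b SE by (intro exI[of _ S] exI[of _ e\<^sub>1] exI[of _ b] exI[of _ "prod D S"]) auto
  qed
qed

text \<open>\<open>K\<close> is covered by finitely many regions, one for each spanning tree, on
  each of which the density has an integrable majorant. The sum of the majorants dominates on all of
  \<open>K\<close>.\<close>

lemma nn_integral_feynman_density_finite:
  fixes G :: "'c::finite cgraph" and q :: "(real ^ 'd::finite) \<Rightarrow> real"
  assumes adm: "admissible n k G" and q: "spacetime_form q" and p: "generic_momenta q k p"
    and defined: "feynman_density_defined q k p m G"
    and K: "compact K" "K \<subseteq> cell G"
  shows "(\<integral>\<^sup>+ x. indicator K x * ennreal (feynman_density q k p m G x) \<partial>hyperplane_measure (edges G) {}) < top"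
proof (cases "K = {}")
  case False
  then obtain x\<^sub>0 where x0: "x\<^sub>0 \<in> cell G" using K by auto
  have wf: "wf_cgraph k G" and con: "graph_connected G (edges G)"
    using adm by (auto simp: admissible_def)
  let ?ST = "spanning_trees G" and ?\<mu> = "hyperplane_measure (edges G) {}"
  let ?h = "feynman_density q k p m G"
  let ?db = "real CARD('d) * of_int (betti G (edges G))"
  obtain z where z: "z \<in> K" "\<And>x. x \<in> K \<Longrightarrow> psi G z \<le> psi G x"
    using continuous_attains_inf[OF K(1) False continuous_on_psi] by blast
  define c where "c = psi G z"
  have c: "0 < c"
    unfolding c_def using psi_pos[OF wf con] z K by blast
  obtain z' where z': "\<And>x. x \<in> K \<Longrightarrow> psi G x \<le> psi G z'"
    using continuous_attains_sup[OF K(1) False continuous_on_psi] by blast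
  obtain z'' where z'': "\<And>x. x \<in> K \<Longrightarrow> Xi q k p m G x \<le> Xi q k p m G z''"
    using continuous_attains_sup[OF K(1) False continuous_on_Xi] by blast
  define M where "M = max (psi G z') (Xi q k p m G z'')"
  define a where "a = max 0 (real (card (edges G)) - ?db / 2)"
  define C where "C = c powr - (real CARD('d) / 2) * (max 1 (M / c) powr \<bar>?db / 2\<bar> + 1 + M powr a)"
  have C: "0 \<le> C" by (simp add: C_def)
  have h: "?h x \<le> C * (1 + Xi q k p m G x powr - a)" if x: "x \<in> K" for x
    unfolding feynman_density_def C_def
  proof (rule powr_density_bound)
    have xc: "x \<in> cell G" using x K by auto
    show "0 \<le> Xi q k p m G x"
      using cell_bounds[OF xc] by (intro Xi_nonneg[OF q p])
    show "- a \<le> superficial_degree CARD('d) G x / 2" "superficial_degree CARD('d) G x / 2 \<le> ?db / 2"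
      using superficial_degree_bounds[OF xc, of "CARD('d)"] max.cobounded2[of "card (edges G) - ?db / 2" 0]
      unfolding a_def by linarith+
    show "psi G x \<le> M" "Xi q k p m G x \<le> M"
      using z'[OF x] z''[OF x] by (auto simp: M_def)
  qed (use c z x in \<open>auto simp: c_def a_def\<close>)
  have cardST: "0 < real (card ?ST)"
    using spanning_tree_extension[OF wf con, of "{}"]
    by (force simp: forest_def betti_empty card_gt_0_iff)
  \<comment> \<open>Pigeonhole: \<open>psi\<close> is at least \<open>c\<close> on \<open>K\<close>,
    so at every point some spanning tree contributes at least the average share
    \<open>c'\<close>.\<close>
  define c' where "c' = c / card ?ST"
  have c': "0 < c'" using c cardST by (simp add: c'_def)
  have "\<forall>T\<in>?ST. \<exists>B. B \<in> borel_measurable borel \<and> integral\<^sup>N ?\<mu> B < top \<and>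
     (\<forall>x\<in>K. c' \<le> tree_weight G T x \<longrightarrow> ennreal (?h x) \<le> B x)"
  proof
    fix T assume T: "T \<in> ?ST"
    obtain S e\<^sub>1 b D where b: "e\<^sub>1 \<in> edges G" "0 \<le> b" "b < 1" "S \<subseteq> edges G - {e\<^sub>1}"
      and bound: "\<And>x. x \<in> cell G \<Longrightarrow> c' \<le> tree_weight G T x \<Longrightarrow>
        ennreal (Xi q k p m G x powr - a) \<le> ennreal D * singular_weight (edges G) S e\<^sub>1 b x"
      using Xi_powr_bound[OF adm q p defined x0 T c' a_def] by blast
    \<comment> \<open>The summand \<open>1\<close> of the density bound costs one copy of the
      weight, the singular summand \<open>D\<close> copies.\<close>
    define B where "B x = ennreal C * (1 + ennreal D) * singular_weight (edges G) S e\<^sub>1 b x" for x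
    have "ennreal (?h x) \<le> B x" if x: "x \<in> K" "c' \<le> tree_weight G T x" for x
    proof -
      have xc: "x \<in> cell G" using x K by auto
      have "ennreal (?h x) \<le> ennreal (C * (1 + Xi q k p m G x powr - a))"
        by (rule ennreal_leI[OF h[OF x(1)]])
      also have "\<dots> = ennreal C * (1 + ennreal (Xi q k p m G x powr - a))"
        using C by (simp add: ennreal_mult ennreal_plus[symmetric] del: ennreal_plus flip: ennreal_1)
      also have "\<dots> \<le> ennreal C * (singular_weight (edges G) S e\<^sub>1 b x + ennreal D * singular_weight (edges G) S e\<^sub>1 b x)"
        using b cell_bounds[OF xc] x xc
        by (intro mult_left_mono add_mono bound singular_weight_ge(1)) auto
      also have "\<dots> = B x"
        by (simp add: B_def algebra_simps)
      finally show ?thesis .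
    qed
    moreover have "integral\<^sup>N ?\<mu> B < top"
      using nn_integral_singular_weight[OF b(1,3), of S]
      unfolding B_def by (subst nn_integral_cmult) (auto simp: ennreal_mult_less_top)
    moreover have "B \<in> borel_measurable borel"
      unfolding B_def by measurable
    ultimately show "\<exists>B. B \<in> borel_measurable borel \<and> integral\<^sup>N ?\<mu> B < top \<and>
     (\<forall>x\<in>K. c' \<le> tree_weight G T x \<longrightarrow> ennreal (?h x) \<le> B x)"
      by blast
  qed
  then obtain B where B: "\<And>T. T \<in> ?ST \<Longrightarrow> B T \<in> borel_measurable borel"
    "\<And>T. T \<in> ?ST \<Longrightarrow> integral\<^sup>N ?\<mu> (B T) < top"
    "\<And>T x. T \<in> ?ST \<Longrightarrow> x \<in> K \<Longrightarrow> c' \<le> tree_weight G T x \<Longrightarrow> ennreal (?h x) \<le> B T x"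
    by metis
  have "indicator K x * ennreal (?h x) \<le> (\<Sum>T\<in>?ST. B T x)" for x
  proof (cases "x \<in> K")
    case True
    have "\<exists>T\<in>?ST. c' \<le> tree_weight G T x"
    proof (rule ccontr)
      assume "\<not> ?thesis"
      then have "(\<Sum>T\<in>?ST. tree_weight G T x) < (\<Sum>T\<in>?ST. c')"
        using cardST by (intro sum_strict_mono) (auto simp: not_le)
      moreover have "(\<Sum>T\<in>?ST. c') = c"
        unfolding sum_constant c'_def using cardST by (metis less_irrefl nonzero_mult_div_cancel_left times_divide_eq_right)
      ultimately have "psi G x < c"
        by (simp only: psi_eq_sum_tree_weight)
      with z(2)[OF True] show False by (simp add: c_def)
    qed
    then obtain T where T: "T \<in> ?ST" "c' \<le> tree_weight G T x" by blast
    have "ennreal (?h x) \<le> B T x" using B(3) T True by blast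
    also have "\<dots> \<le> (\<Sum>T\<in>?ST. B T x)"
      using T by (intro member_le_sum) auto
    finally show ?thesis using True by simp
  qed simp
  then have "(\<integral>\<^sup>+ x. indicator K x * ennreal (?h x) \<partial>?\<mu>) \<le> (\<integral>\<^sup>+ x. (\<Sum>T\<in>?ST. B T x) \<partial>?\<mu>)"
    by (intro nn_integral_mono)
  also have "\<dots> = (\<Sum>T\<in>?ST. integral\<^sup>N ?\<mu> (B T))"
    using B(1) by (intro nn_integral_sum) (simp add: measurable_cong_sets[OF sets_hyperplane_measure refl])
  also have "\<dots> < top"
    using B(2) by (simp add: less_top[symmetric])
  finally show ?thesis .
qed simp

section \<open>Test functions\<close>

lemma continuous_on_test_function:
  assumes "\<phi> \<in> test_functions G"
  shows "continuous_on (cell G) \<phi>"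
  unfolding continuous_on
proof
  fix x assume x: "x \<in> cell G"
  then obtain U g where U: "open U" "x \<in> U" "smooth_on U g" "\<And>y. y \<in> U \<inter> cell G \<Longrightarrow> \<phi> y = g y"
    using assms by (auto simp: test_functions_def)
  have "Ck_on 0 U g"
    using U(3) by (simp only: smooth_on_def)
  then have "(g \<longlongrightarrow> g x) (at x within U)"
    using U(2) by (simp add: continuous_on)
  then have "(g \<longlongrightarrow> g x) (at x within cell G)"
    using U(1,2) tendsto_within_subset[OF _ subset_UNIV] by (simp add: at_within_open[of x U]) blast
  moreover have "\<forall>\<^sub>F y in at x within cell G. g y = \<phi> y"
    unfolding eventually_at_topological using U by (metis IntI)
  ultimately have "(\<phi> \<longlongrightarrow> g x) (at x within cell G)"
    by (rule Lim_transform_eventually)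
  then show "(\<phi> \<longlongrightarrow> \<phi> x) (at x within cell G)"
    using U(2,4) x by simp
qed

section \<open>Measurability of cells and densities\<close>

text \<open>A cell is in general neither open nor closed. It is the finite union over forests
  \<open>F\<close> of the faces where exactly \<open>F\<close> has length \<open>0\<close>, each an
  intersection of an open and a closed set.\<close>

lemma cell_borel: "cell G \<in> sets borel"
proof -
  have open_face: "{x :: real ^ 'a. (\<forall>e\<in>A. 0 < x $ e) \<and> (\<forall>e\<in>B. x $ e = 0) \<and> (\<Sum>e\<in>C. x $ e) = 1} \<in> sets borel"
    (is "?X \<in> _") for A B C :: "'a set"
  proof -
    have "?X = (\<Inter>e\<in>A. {x. 0 < x $ e}) \<inter> ((\<Inter>e\<in>B. {x. x $ e = 0}) \<inter> {x. (\<Sum>e\<in>C. x $ e) = 1})"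
      by auto
    moreover have "(\<Inter>e\<in>A. {x :: real ^ 'a. 0 < x $ e}) \<in> sets borel"
      by (intro borel_open open_INT ballI open_Collect_less continuous_intros) simp
    moreover have "(\<Inter>e\<in>B. {x :: real ^ 'a. x $ e = 0}) \<inter> {x. (\<Sum>e\<in>C. x $ e) = 1} \<in> sets borel"
      by (intro borel_closed closed_Int closed_INT ballI closed_Collect_eq continuous_intros)
    ultimately show ?thesis
      by (simp only: sets.Int)
  qed
  have "cell G = (\<Union>F\<in>{F. F \<subseteq> edges G \<and> forest G F}.
      {x. (\<forall>e\<in>edges G - F. 0 < x $ e) \<and> (\<forall>e\<in>- (edges G - F). x $ e = 0) \<and> (\<Sum>e\<in>edges G. x $ e) = 1})"
    (is "_ = (\<Union>F\<in>?I. ?Y F)")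
  proof (intro set_eqI iffI)
    fix x assume x: "x \<in> cell G"
    then have "zero_edges G x \<in> ?I"
      by (auto simp: cell_def zero_edges_def)
    moreover have "x \<in> ?Y (zero_edges G x)"
      using x by (auto simp: cell_def zero_edges_def order_less_le)
    ultimately show "x \<in> (\<Union>F\<in>?I. ?Y F)" by blast
  next
    fix x assume "x \<in> (\<Union>F\<in>?I. ?Y F)"
    then obtain F where F: "F \<subseteq> edges G" "forest G F" and x: "x \<in> ?Y F" by blast
    have "zero_edges G x = F"
    proof -
      have "x $ e = 0 \<longleftrightarrow> e \<in> F" if "e \<in> edges G" for e
        using x that by (cases "e \<in> F") force+
      then show ?thesis
        using F(1) by (auto simp: zero_edges_def)
    qed
    moreover have "0 \<le> x $ e" for e
      using x by (cases "e \<in> edges G - F") (auto intro: less_imp_le)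
    ultimately show "x \<in> cell G"
      using x F(2) by (simp add: cell_def)
  qed
  also have "\<dots> \<in> sets borel"
    by (intro sets.finite_UN open_face) auto
  finally show ?thesis .
qed

lemma measurable_feynman_density: "feynman_density q k p m G \<in> borel_measurable borel"
proof -
  have [measurable]: "psi G \<in> borel_measurable borel" "Xi q k p m G \<in> borel_measurable borel"
    by (intro borel_measurable_continuous_onI continuous_on_psi continuous_on_Xi)+
  have [measurable]: "heaviside \<in> borel_measurable borel"
    unfolding heaviside_def[abs_def] by measurable
  have [measurable]: "(\<lambda>x :: real ^ 'b. x $ e) \<in> borel_measurable borel" for e
    by (intro borel_measurable_continuous_onI continuous_intros)
  have [measurable]: "superficial_degree d G \<in> borel_measurable borel" for d
    unfolding superficial_degree_def[abs_def] by measurable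
  show ?thesis
    unfolding feynman_density_def[abs_def] by measurable
qed

lemma feynman_density_nonneg: "0 \<le> feynman_density q k p m G x"
  by (simp add: feynman_density_def)

section \<open>The distribution of a single graph\<close>

locale feynman_integrand =
  fixes n k :: nat and G :: "'c::finite cgraph"
    and q :: "(real ^ 'd::finite) \<Rightarrow> real" and p :: "nat \<Rightarrow> (real ^ 'd)" and m :: "'c \<Rightarrow> real"
  assumes adm: "admissible n k G" and q: "spacetime_form q" and p: "generic_momenta q k p"
    and density_defined: "feynman_density_defined q k p m G"
begin

abbreviation "integrand \<equiv> feynman_density q k p m G"

definition mass :: "(real ^ 'c) set \<Rightarrow> ennreal" where
  "mass K = (\<integral>\<^sup>+ x. indicator K x * ennreal (integrand x) \<partial>hyperplane_measure (edges G) {})"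

lemma mass_finite: "compact K \<Longrightarrow> K \<subseteq> cell G \<Longrightarrow> mass K < top"
  unfolding mass_def
  by (rule nn_integral_feynman_density_finite[OF adm q p density_defined])

lemma nn_integral_norm_le:
  assumes K: "K \<in> sets borel" and B: "\<And>x. x \<in> cell G \<Longrightarrow> norm (\<phi> x) \<le> B" and supp: "\<And>x. x \<notin> K \<Longrightarrow> \<phi> x = 0"
  shows "(\<integral>\<^sup>+ x. norm (indicator (cell G) x *\<^sub>R (\<phi> x * complex_of_real (integrand x))) \<partial>hyperplane_measure (edges G) {})
    \<le> ennreal B * mass K"
proof -
  have "(\<integral>\<^sup>+ x. norm (indicator (cell G) x *\<^sub>R (\<phi> x * complex_of_real (integrand x))) \<partial>hyperplane_measure (edges G) {})
    \<le> (\<integral>\<^sup>+ x. ennreal B * (indicator K x * ennreal (integrand x)) \<partial>hyperplane_measure (edges G) {})"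
  proof (rule nn_integral_mono)
    fix x
    show "ennreal (norm (indicator (cell G) x *\<^sub>R (\<phi> x * complex_of_real (integrand x)))) \<le>
        ennreal B * (indicator K x * ennreal (integrand x))"
    proof (cases "x \<in> cell G \<and> x \<in> K")
      case True
      then have "0 \<le> B" "norm (\<phi> x) \<le> B"
        using B[of x] norm_ge_zero[of "\<phi> x"] by linarith+
      then have "norm (\<phi> x * complex_of_real (integrand x)) \<le> B * integrand x"
        unfolding norm_mult norm_of_real
        by (intro mult_mono) (simp_all add: feynman_density_nonneg)
      then have "ennreal (norm (\<phi> x * complex_of_real (integrand x))) \<le> ennreal (B * integrand x)"
        by (rule ennreal_leI)
      also have "\<dots> = ennreal B * ennreal (integrand x)"
        using \<open>0 \<le> B\<close> feynman_density_nonneg by (rule ennreal_mult)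
      finally show ?thesis
        using True by simp
    qed (auto simp: supp)
  qed
  also have "\<dots> = ennreal B * mass K"
    unfolding mass_def
  proof (rule nn_integral_cmult)
    have "(\<lambda>x. indicator K x * ennreal (integrand x)) \<in> borel_measurable borel"
      using measurable_feynman_density K by measurable
    then show "(\<lambda>x. indicator K x * ennreal (integrand x)) \<in> borel_measurable (hyperplane_measure (edges G) {})"
      by (simp add: measurable_cong_sets[OF sets_hyperplane_measure refl])
  qed
  finally show ?thesis .
qed

lemma integrable_test_function:
  assumes \<phi>: "\<phi> \<in> test_functions G"
  shows "set_integrable (hyperplane_measure (edges G) {}) (cell G) (\<lambda>x. \<phi> x * complex_of_real (integrand x))"
proof -
  obtain K where K: "compact K" "K \<subseteq> cell G" "\<And>x. x \<notin> K \<Longrightarrow> \<phi> x = 0"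
    using \<phi> by (auto simp: test_functions_def)
  have cont: "continuous_on (cell G) \<phi>"
    by (rule continuous_on_test_function[OF \<phi>])
  have "bounded (\<phi> ` K)"
    using K(1) continuous_on_subset[OF cont K(2)] by (intro compact_imp_bounded compact_continuous_image)
  then obtain B where "\<And>x. x \<in> K \<Longrightarrow> norm (\<phi> x) \<le> B"
    by (auto simp: bounded_iff)
  then have B: "norm (\<phi> x) \<le> max B 0" for x
    using K(3)[of x] by (cases "x \<in> K") (auto intro: max.coboundedI1)
  \<comment> \<open>Continuity of the test function is known on the cell only, so measurability is
    obtained after multiplication by the indicator.\<close>
  have "(\<lambda>x. indicator (cell G) x *\<^sub>R \<phi> x) \<in> borel_measurable borel"
    by (intro borel_measurable_continuous_on_indicator cell_borel cont)
  moreover have "(\<lambda>x. complex_of_real (integrand x)) \<in> borel_measurable borel"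
    using measurable_feynman_density by measurable
  ultimately have "(\<lambda>x. (indicator (cell G) x *\<^sub>R \<phi> x) * complex_of_real (integrand x)) \<in> borel_measurable borel"
    by (rule borel_measurable_times)
  then have meas: "(\<lambda>x. indicator (cell G) x *\<^sub>R (\<phi> x * complex_of_real (integrand x)))
      \<in> borel_measurable (hyperplane_measure (edges G) {})"
    by (simp add: measurable_cong_sets[OF sets_hyperplane_measure refl])
  have "(\<integral>\<^sup>+ x. norm (indicator (cell G) x *\<^sub>R (\<phi> x * complex_of_real (integrand x))) \<partial>hyperplane_measure (edges G) {})
      \<le> ennreal (max B 0) * mass K"
    by (rule nn_integral_norm_le[OF borel_compact[OF K(1)] B K(3)])
  also have "\<dots> < \<infinity>"
    using mass_finite[OF K(1,2)] by (simp add: ennreal_mult_less_top)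
  finally show ?thesis
    unfolding set_integrable_def integrable_iff_bounded using meas by blast
qed

text \<open>On a fixed compact support the functional is bounded in the supremum norm, with no
  derivatives; continuity follows from this.\<close>

lemma norm_feynman_distribution_le:
  assumes \<phi>: "\<phi> \<in> test_functions G" and K: "compact K" "K \<subseteq> cell G"
    and B: "0 \<le> B" "\<And>x. x \<in> cell G \<Longrightarrow> norm (\<phi> x) \<le> B" and supp: "\<And>x. x \<notin> K \<Longrightarrow> \<phi> x = 0"
  shows "norm (feynman_distribution q k p m G \<phi>) \<le> B * enn2real (mass K)"
proof -
  have "ennreal (norm (feynman_distribution q k p m G \<phi>)) \<le> ennreal B * mass K"
    unfolding feynman_distribution_def regular_distribution_def set_lebesgue_integral_def
    using integral_norm_bound_ennreal[OF integrable_test_function[OF \<phi>, unfolded set_integrable_def]]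
      nn_integral_norm_le[OF borel_compact[OF K(1)] B(2) supp]
    by (rule order_trans)
  also have "\<dots> = ennreal (B * enn2real (mass K))"
    using mass_finite[OF K] B(1) by (simp add: ennreal_mult)
  finally show ?thesis
    using B(1) by (simp add: ennreal_le_iff)
qed

lemma feynman_distribution_linear:
  assumes \<phi>: "\<phi> \<in> test_functions G" and \<psi>: "\<psi> \<in> test_functions G"
  shows "feynman_distribution q k p m G (\<lambda>x. a * \<phi> x + b * \<psi> x) =
    a * feynman_distribution q k p m G \<phi> + b * feynman_distribution q k p m G \<psi>"
proof -
  have eq: "(a * \<phi> x + b * \<psi> x) * complex_of_real (integrand x) =
      a * (\<phi> x * complex_of_real (integrand x)) + b * (\<psi> x * complex_of_real (integrand x))" for x
    by (simp add: algebra_simps)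
  show ?thesis
    unfolding feynman_distribution_def regular_distribution_def eq
    using integrable_test_function[OF \<phi>] integrable_test_function[OF \<psi>]
    by (subst set_integral_add(2)) (auto intro: set_integrable_mult_right)
qed

text \<open>\<open>tends_to_zero\<close> gives bounds on the open simplex only; approximation
  carries them over to the faces. Moving a point towards the barycentre makes all lengths
  positive.\<close>

lemma cell_approx:
  assumes x: "x \<in> cell G"
  obtains y where "\<And>i. y i \<in> open_simplex (edges G)" "\<And>i. y i \<in> cell G" "y \<longlonglongrightarrow> x"
proof -
  let ?E = "edges G"
  have E: "?E \<noteq> {}" using x by (auto simp: cell_def)
  then have cE: "real (card ?E) > 0" by (simp add: card_gt_0_iff)
  define t where "t i = inverse (real (Suc i))" for i
  have t: "0 < t i" "t i \<le> 1" for i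
    by (auto simp: t_def inverse_le_1_iff)
  define b :: "real ^ 'c" where "b = (\<chi> e. if e \<in> ?E then 1 / card ?E else 0)"
  define y where "y i = (1 - t i) *\<^sub>R x + t i *\<^sub>R b" for i
  have sumb: "(\<Sum>e\<in>?E. b $ e) = 1"
    using E by (simp add: b_def)
  have os: "y i \<in> open_simplex ?E" for i
    unfolding open_simplex_def
  proof (intro CollectI conjI ballI allI impI)
    fix e assume e: "e \<in> ?E"
    then have "0 < b $ e" using cE by (simp add: b_def card_gt_0_iff)
    then show "0 < y i $ e"
      using t[of i] cell_bounds(1)[OF x e] by (simp add: y_def add_nonneg_pos)
  next
    fix e assume "e \<notin> ?E"
    then show "y i $ e = 0" using x by (simp add: y_def b_def cell_def)
  next
    have "(\<Sum>e\<in>?E. y i $ e) = (1 - t i) * (\<Sum>e\<in>?E. x $ e) + t i * (\<Sum>e\<in>?E. b $ e)"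
      by (simp add: y_def sum.distrib sum_distrib_left)
    then show "(\<Sum>e\<in>?E. y i $ e) = 1"
      using x sumb by (simp add: cell_def)
  qed
  moreover have "z \<in> cell G" if z: "z \<in> open_simplex ?E" for z
  proof -
    have "zero_edges G z = {}"
      using z by (auto simp: zero_edges_def open_simplex_def)
    then show ?thesis
      using z by (auto simp: cell_def open_simplex_def forest_def betti_empty less_imp_le)
  qed
  moreover have "y \<longlonglongrightarrow> x"
  proof -
    have "t \<longlonglongrightarrow> 0"
      unfolding t_def by (rule LIMSEQ_inverse_real_of_nat)
    then have "y \<longlonglongrightarrow> (1 - 0) *\<^sub>R x + 0 *\<^sub>R b"
      unfolding y_def by (intro tendsto_intros)
    then show ?thesis by simp
  qed
  ultimately show thesis
    using that by blast
qed

lemma distribution_feynman: "distribution G (feynman_distribution q k p m G)"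
  unfolding distribution_def
proof (intro conjI ballI allI impI)
  fix \<phi> assume \<phi>: "(\<forall>j. \<phi> j \<in> test_functions G) \<and> tends_to_zero G \<phi>"
  then obtain K where K: "compact K" "K \<subseteq> cell G" "\<And>j x. x \<notin> K \<Longrightarrow> \<phi> j x = 0"
    by (auto simp: tends_to_zero_def)
  have "\<forall>vs. set vs \<subseteq> tangent_directions (edges G) \<longrightarrow>
      uniform_limit (open_simplex (edges G)) (\<lambda>j. iterated_deriv vs (\<phi> j)) (\<lambda>_. 0) sequentially"
    using \<phi> unfolding tends_to_zero_def by blast
  \<comment> \<open>The empty list of directions selects uniform convergence of the functions
    themselves.\<close>
  from this[rule_format, of "[]"]
  have unif: "uniform_limit (open_simplex (edges G)) \<phi> (\<lambda>_. 0) sequentially"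
    by simp
  let ?c = "enn2real (mass K)"
  show "(\<lambda>j. feynman_distribution q k p m G (\<phi> j)) \<longlonglongrightarrow> 0"
  proof (rule tendstoI)
    fix \<epsilon> :: real assume \<epsilon>: "0 < \<epsilon>"
    \<comment> \<open>Adding \<open>1\<close> avoids division by \<open>0\<close> when the mass of
      \<open>K\<close> vanishes.\<close>
    define \<delta> where "\<delta> = \<epsilon> / (?c + 1)"
    have c: "0 < ?c + 1"
      by (simp add: add_nonneg_pos)
    then have \<delta>: "0 < \<delta>"
      using \<epsilon> by (simp add: \<delta>_def)
    have "\<delta> * ?c < \<delta> * (?c + 1)"
      using \<delta> by (intro mult_strict_left_mono) auto
    also have "\<dots> = \<epsilon>"
      using c by (simp add: \<delta>_def)
    finally have \<delta>c: "\<delta> * ?c < \<epsilon>" .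
    from uniform_limitD[OF unif \<delta>]
    show "\<forall>\<^sub>F j in sequentially. dist (feynman_distribution q k p m G (\<phi> j)) 0 < \<epsilon>"
    proof eventually_elim
      case (elim j)
      have test: "\<phi> j \<in> test_functions G" using \<phi> by blast
      have "norm (\<phi> j x) \<le> \<delta>" if x: "x \<in> cell G" for x
      proof -
        obtain y where y: "\<And>i. y i \<in> open_simplex (edges G)" "\<And>i. y i \<in> cell G" "y \<longlonglongrightarrow> x"
          using cell_approx[OF x] by blast
        have "(\<lambda>i. \<phi> j (y i)) \<longlonglongrightarrow> \<phi> j x"
          using continuous_on_test_function[OF test] x y(2,3)
          unfolding continuous_on_sequentially comp_def by blast
        then have "(\<lambda>i. norm (\<phi> j (y i))) \<longlonglongrightarrow> norm (\<phi> j x)"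
          by (rule tendsto_norm)
        then show ?thesis
          using elim y(1) by (intro LIMSEQ_le_const2) (auto intro: less_imp_le)
      qed
      then have "norm (feynman_distribution q k p m G (\<phi> j)) \<le> \<delta> * ?c"
        using \<delta> by (intro norm_feynman_distribution_le[OF test K(1,2)] K(3)) auto
      with \<delta>c show ?case by simp
    qed
  qed
qed (rule feynman_distribution_linear)

end

section \<open>Faces\<close>

text \<open>Both measures eliminate the same coordinate, as both choose it from
  \<open>E - F\<close>. Fubini then integrates out the Dirac factors, which set the coordinates in
  \<open>F\<close> to \<open>0\<close>.\<close>

lemma hyperplane_measure_face:
  fixes E :: "'c::finite set"
  assumes F: "F \<subseteq> E" "E - F \<noteq> {}"
  shows "hyperplane_measure (E - F) {} = hyperplane_measure E F"
proof -
  define e\<^sub>0 where "e\<^sub>0 = (SOME e. e \<in> E - F)"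
  have e0: "e\<^sub>0 \<in> E - F"
    unfolding e\<^sub>0_def some_in_eq by (rule F(2))
  define A where "A = E - F - {e\<^sub>0}"
  define D :: "'c \<Rightarrow> real measure" where "D e = (if e \<in> F then return lborel 0 else lborel)" for e
  have E: "E - {e\<^sub>0} = A \<union> F" "A \<inter> F = {}"
    using F e0 by (auto simp: A_def)
  interpret D: product_sigma_finite D
    unfolding product_sigma_finite_def D_def
    by (auto intro!: prob_space_imp_sigma_finite prob_space_return lborel.sigma_finite_measure_axioms)
  have DA: "PiM A D = PiM A (\<lambda>_. lborel)"
    using E by (intro PiM_cong) (auto simp: D_def)
  \<comment> \<open>The product of the Dirac measures is the Dirac measure at the zero function on
    \<open>F\<close>.\<close>
  have DF: "PiM F D = return (PiM F (\<lambda>_. lborel)) (restrict (\<lambda>_. 0) F)"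
  proof -
    have "PiM F D = PiM F (\<lambda>_. return lborel 0)"
      by (intro PiM_cong) (auto simp: D_def)
    then show ?thesis
      by (simp add: PiM_return)
  qed
  have "sets (D e) = sets borel" for e
    by (simp add: D_def)
  then have hp: "hyperplane_point E e\<^sub>0 \<in> PiM (A \<union> F) D \<rightarrow>\<^sub>M borel"
    using measurable_hyperplane_point[of E e\<^sub>0 D] by (simp add: E)
  have hp': "hyperplane_point (E - F) e\<^sub>0 \<in> PiM A (\<lambda>_. lborel) \<rightarrow>\<^sub>M borel"
    unfolding A_def by (rule measurable_hyperplane_point) simp
  have point: "hyperplane_point E e\<^sub>0 (merge A F (y, \<lambda>_. 0)) = hyperplane_point (E - F) e\<^sub>0 y"
    (is "?l = ?r") for y
  proof -
    have "(\<Sum>e\<in>E - {e\<^sub>0}. merge A F (y, \<lambda>_. 0) e) = (\<Sum>e\<in>A. y e)"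
      unfolding E(1) using E(2)
      by (intro sum.mono_neutral_cong_right) (auto simp: merge_def)
    then have "?l $ e = ?r $ e" for e
      using e0 by (auto simp: hyperplane_point_def A_def merge_def)
    then show ?thesis
      unfolding vec_eq_iff by (rule allI)
  qed
  have "distr (PiM A (\<lambda>_. lborel)) borel (hyperplane_point (E - F) e\<^sub>0) =
      distr (PiM (A \<union> F) D) borel (hyperplane_point E e\<^sub>0)"
  proof (rule measure_eqI)
    fix X assume "X \<in> sets (distr (PiM A (\<lambda>_. lborel)) borel (hyperplane_point (E - F) e\<^sub>0))"
    then have X: "X \<in> sets borel" by simp
    have "emeasure (distr (PiM (A \<union> F) D) borel (hyperplane_point E e\<^sub>0)) X =
        (\<integral>\<^sup>+ x. indicator X x \<partial>distr (PiM (A \<union> F) D) borel (hyperplane_point E e\<^sub>0))"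
      using X by simp
    also have "\<dots> = (\<integral>\<^sup>+ y. indicator X (hyperplane_point E e\<^sub>0 y) \<partial>PiM (A \<union> F) D)"
      using X by (intro nn_integral_distr hp) simp
    also have "\<dots> = (\<integral>\<^sup>+ y. \<integral>\<^sup>+ z. indicator X (hyperplane_point E e\<^sub>0 (merge A F (y, z))) \<partial>PiM F D \<partial>PiM A D)"
      using X by (intro D.product_nn_integral_fold E(2) finite measurable_compose[OF hp]) simp
    also have "\<dots> = (\<integral>\<^sup>+ y. indicator X (hyperplane_point (E - F) e\<^sub>0 y) \<partial>PiM A D)"
    proof (rule nn_integral_cong)
      fix y assume y: "y \<in> space (PiM A D)"
      have "(\<lambda>z. merge A F (y, z)) \<in> PiM F D \<rightarrow>\<^sub>M PiM (A \<union> F) D"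
        using measurable_Pair1'[OF y] measurable_merge by (rule measurable_compose)
      then have "(\<lambda>z. hyperplane_point E e\<^sub>0 (merge A F (y, z))) \<in> PiM F D \<rightarrow>\<^sub>M borel"
        using hp by (rule measurable_compose)
      then have "(\<lambda>z. indicator X (hyperplane_point E e\<^sub>0 (merge A F (y, z)))) \<in> borel_measurable (PiM F D)"
        by (rule measurable_compose) (use X in simp)
      then have meas: "(\<lambda>z. indicator X (hyperplane_point E e\<^sub>0 (merge A F (y, z))) :: ennreal)
          \<in> borel_measurable (PiM F (\<lambda>_. lborel))"
        unfolding DF by simp
      show "(\<integral>\<^sup>+ z. indicator X (hyperplane_point E e\<^sub>0 (merge A F (y, z))) \<partial>PiM F D) =
          indicator X (hyperplane_point (E - F) e\<^sub>0 y)"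
        unfolding DF by (subst nn_integral_return[OF _ meas]) (simp_all add: point space_PiM)
    qed
    also have "\<dots> = (\<integral>\<^sup>+ x. indicator X x \<partial>distr (PiM A (\<lambda>_. lborel)) borel (hyperplane_point (E - F) e\<^sub>0))"
      unfolding DA using X by (intro nn_integral_distr[symmetric] hp') simp
    also have "\<dots> = emeasure (distr (PiM A (\<lambda>_. lborel)) borel (hyperplane_point (E - F) e\<^sub>0)) X"
      using X by simp
    finally show "emeasure (distr (PiM A (\<lambda>_. lborel)) borel (hyperplane_point (E - F) e\<^sub>0)) X =
        emeasure (distr (PiM (A \<union> F) D) borel (hyperplane_point E e\<^sub>0)) X" ..
  qed simp
  moreover have "hyperplane_measure E F = distr (PiM (A \<union> F) D) borel (hyperplane_point E e\<^sub>0)"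
    unfolding hyperplane_measure_def Let_def e\<^sub>0_def[symmetric] E(1) D_def[abs_def] ..
  moreover have "hyperplane_measure (E - F) {} = distr (PiM A (\<lambda>_. lborel)) borel (hyperplane_point (E - F) e\<^sub>0)"
    unfolding hyperplane_measure_eq hyperplane_lborel_def e\<^sub>0_def[symmetric] A_def ..
  ultimately show ?thesis by simp
qed

lemma respects_face_relations_feynman:
  fixes m :: "'c::finite \<Rightarrow> real"
  assumes q: "spacetime_form q" and p: "generic_momenta q k p"
  shows "respects_face_relations n k (feynman_density q k p m)"
  unfolding respects_face_relations_def
proof (intro ballI allI impI)
  fix G :: "'c cgraph" and F \<phi>
  assume G: "G \<in> holocoloured n k" and F: "forest G F" and \<phi>: "\<phi> \<in> test_functions (contract G F)"
  let ?H = "contract G F" and ?h = "feynman_density q k p m"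
  have wf: "wf_cgraph k G"
    using G by (simp add: holocoloured_def admissible_def)
  note c = collapses_contract[OF wf F]
  have cell: "cell ?H = {x \<in> cell G. \<forall>e\<in>F. x $ e = 0}"
    by (rule cell_collapse[OF c])
  have zero: "\<phi> x = 0" if "x \<notin> cell ?H" for x
    using \<phi> that by (auto simp: test_functions_def)
  \<comment> \<open>On the smaller cell the densities agree, including their discontinuous
    exponents; elsewhere the test function is \<open>0\<close>.\<close>
  have integrand: "indicator (cell ?H) x *\<^sub>R (\<phi> x * complex_of_real (?h ?H x)) =
      indicator (cell G) x *\<^sub>R (\<phi> x * complex_of_real (?h G x))" for x
  proof (cases "x \<in> cell ?H")
    case True
    then have "?h ?H x = ?h G x"
      using cell by (intro feynman_density_collapse[OF c _ q p]) blast
    with True cell show ?thesis by simp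
  qed (simp add: zero)
  have E: "edges ?H = edges G - F"
    by (simp add: contract_def)
  show "regular_distribution ?H (?h ?H) \<phi> = face_restriction G F (?h G) \<phi>"
  \<comment> \<open>If every edge is contracted there is no coordinate to eliminate, but then the
    cell is empty, since lengths add up to \<open>1\<close>, and both integrals vanish.\<close>
  proof (cases "edges G - F = {}")
    case True
    then have "cell ?H = {}"
      unfolding cell_def E True by auto
    then have "\<phi> x = 0" for x
      using zero by blast
    then show ?thesis
      by (simp add: regular_distribution_def face_restriction_def)
  next
    case False
    have "F \<subseteq> edges G" using F by (simp add: forest_def)
    from hyperplane_measure_face[OF this False] show ?thesis
      by (simp only: regular_distribution_def face_restriction_def set_lebesgue_integral_def integrand E)
  qed
qed

section \<open>Independence of representatives and assembly over all cells\<close>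

text \<open>Isomorphisms fix the colours, so both integrals run over the same vectors of edge
  lengths. The densities agree by the collapse lemmas with \<open>F = {}\<close>.\<close>

lemma feynman_distribution_isomorphic:
  assumes q: "spacetime_form q" and p: "generic_momenta q k p"
    and wf: "wf_cgraph k G" and iso: "isomorphic k G H"
  shows "feynman_distribution q k p m G = feynman_distribution q k p m H"
proof -
  obtain g where c: "collapses k G {} H g"
    using collapses_isomorphic[OF wf iso] .
  have "edges H = edges G"
    using c by (simp add: collapses_def)
  moreover have "cell H = cell G"
    using cell_collapse[OF c] by simp
  moreover have "feynman_density q k p m H = feynman_density q k p m G"
    by (rule ext) (rule feynman_density_collapse[OF c _ q p], simp)
  ultimately show ?thesis
    by (simp add: feynman_distribution_def regular_distribution_def[abs_def])
qed

lemma some_iso_class_holocoloured: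
  assumes "\<G> \<in> iso_class n k ` holocoloured n k"
  shows "(SOME G. G \<in> \<G>) \<in> holocoloured n k"
proof -
  obtain G where G: "G \<in> holocoloured n k" "\<G> = iso_class n k G"
    using assms by blast
  have "isomorphic k G G"
    unfolding isomorphic_def by (auto intro!: exI[of _ id])
  with G have "G \<in> \<G>" by (simp add: iso_class_def)
  then have "(SOME G. G \<in> \<G>) \<in> \<G>" by (rule someI)
  with G show ?thesis by (simp add: iso_class_def)
qed

text \<open>Integrability is asserted separately because the integral of a function that is not
  integrable is \<open>0\<close> by convention; it ensures that the values of the distributions are
  genuine integrals.\<close>

theorem proposition6p2:
  fixes n k :: nat
    and q :: "(real ^ 'd::finite) \<Rightarrow> real"
    and p :: "nat \<Rightarrow> (real ^ 'd)"
    and m :: "'c::finite \<Rightarrow> real"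
  assumes colours: "CARD('c) = 3 * n + k - 3"
    and dimension: "even CARD('d)"
    and form: "spacetime_form q"
    and masses: "\<forall>c. 0 \<le> m c"
    and momenta: "generic_momenta q k p"
    and defined: "\<forall>G\<in>holocoloured n k. feynman_density_defined q k p m G"
  shows "(\<forall>G\<in>holocoloured n k. \<forall>\<phi>\<in>test_functions G.
            set_integrable (hyperplane_measure (edges G) {}) (cell G)
              (\<lambda>x. \<phi> x * complex_of_real (feynman_density q k p m G x))) \<and>
         piecewise_distribution n k (feynman_distribution q k p m) \<and>
         respects_face_relations n k (feynman_density q k p m)"
proof (intro conjI)
  have integrand: "feynman_integrand n k G q p m" if "G \<in> holocoloured n k" for G
    using that form momenta defined by unfold_locales (auto simp: holocoloured_def)
  show "\<forall>G\<in>holocoloured n k. \<forall>\<phi>\<in>test_functions G.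
      set_integrable (hyperplane_measure (edges G) {}) (cell G)
        (\<lambda>x. \<phi> x * complex_of_real (feynman_density q k p m G x))"
    using feynman_integrand.integrable_test_function[OF integrand] by blast
  show "piecewise_distribution n k (feynman_distribution q k p m)"
    unfolding piecewise_distribution_def
  proof (intro conjI ballI allI impI)
    show "distribution G (feynman_distribution q k p m G)" if "G \<in> holocoloured n k" for G
      by (rule feynman_integrand.distribution_feynman[OF integrand[OF that]])
  next
    fix G H :: "'c cgraph" and \<phi>
    assume "G \<in> holocoloured n k" "isomorphic k G H"
    then have "feynman_distribution q k p m G = feynman_distribution q k p m H"
      by (intro feynman_distribution_isomorphic[OF form momenta]) (auto simp: holocoloured_def admissible_def)
    then show "feynman_distribution q k p m G \<phi> = feynman_distribution q k p m H \<phi>"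
      by simp
  next
    fix \<Phi> \<Psi> :: "'c cgraph set \<times> (real ^ 'c) \<Rightarrow> complex" and a b
    assume \<Phi>: "\<Phi> \<in> moduli_test_functions n k" and \<Psi>: "\<Psi> \<in> moduli_test_functions n k"
    let ?u = "feynman_distribution q k p m"
    have "?u G (restrict_to_cell n k (\<lambda>z. a * \<Phi> z + b * \<Psi> z) G) =
        a * ?u G (restrict_to_cell n k \<Phi> G) + b * ?u G (restrict_to_cell n k \<Psi> G)"
      if G: "G \<in> holocoloured n k" for G
    proof -
      have "restrict_to_cell n k (\<lambda>z. a * \<Phi> z + b * \<Psi> z) G =
          (\<lambda>x. a * restrict_to_cell n k \<Phi> G x + b * restrict_to_cell n k \<Psi> G x)"
        by (auto simp: restrict_to_cell_def)
      then show ?thesis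
        using feynman_integrand.feynman_distribution_linear[OF integrand[OF G]] \<Phi> \<Psi> G
        by (simp add: moduli_test_functions_def)
    qed
    then show "evaluate n k ?u (\<lambda>z. a * \<Phi> z + b * \<Psi> z) = a * evaluate n k ?u \<Phi> + b * evaluate n k ?u \<Psi>"
      by (simp add: evaluate_def Let_def some_iso_class_holocoloured sum.distrib sum_distrib_left cong: sum.cong)
  qed
  show "respects_face_relations n k (feynman_density q k p m)"
    by (rule respects_face_relations_feynman[OF form momenta])
qed

end
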